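(* Let $n \in \{3,4,6\}$ and let $K$ be a number field containing the $n$-th roots of unity. Then for every elliptic curve $E$ defined over $K$, there are infinitely many $\mathbb{Z}/n\mathbb{Z}$-extensions $L$ of $K$ (i.e. Galois extensions with $\mathrm{Gal}(L/K)\cong \mathbb{Z}/n\mathbb{Z}$) over which $E$ gains rank.
   Context: $E$ is an elliptic curve over the number field $K$, given by a Weierstrass equation $y^2 = x^3 + Ax + B$ with $A,B\in K$, with identity the point at infinity $O$. Definition: $E$ gains rank over an extension $L$ of $K$ if there is a point $P \in E(L)$ such that, for every non-zero integer $m$, the Galois extension of $K$ generated by (the coordinates of) $mP$ is $L$. *)

theory Defs
  imports Complex_Main "HOL-Algebra.Algebra" "HOL-Algebra.Algebraic_Closure_Type"
begin

text \<open>
  All fields live inside the complex numbers. Every number field embeds into the complex numbers,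
  which also contain an algebraic closure of it, so this loses no generality. Extensions are
  counted as subfields of this fixed algebraically closed field; for Galois extensions of K,
  distinct subfields are also non-isomorphic over K.
\<close>

abbreviation CC :: "complex ring"
  where "CC \<equiv> ring_of_type_algebra"

definition number_field :: "complex set \<Rightarrow> bool"
  where "number_field K \<longleftrightarrow> subfield K CC \<and> ring.finite_dimension CC \<rat> K"

text \<open>Automorphisms are extensional functions, so each one is counted once; the group law,
  inherited from \<^const>\<open>BijGroup\<close>, is composition.\<close>

definition galois_group :: "complex set \<Rightarrow> complex set \<Rightarrow> (complex \<Rightarrow> complex) monoid"
  where "galois_group K L =
    BijGroup L \<lparr>carrier := {s \<in> Bij L.
      s \<in> ring_hom (CC\<lparr>carrier := L\<rparr>) (CC\<lparr>carrier := L\<rparr>) \<and> (\<forall>x\<in>K. s x = x)}\<rparr>"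

definition galois_extension :: "complex set \<Rightarrow> complex set \<Rightarrow> bool"
  where "galois_extension K L \<longleftrightarrow>
    subfield K CC \<and> subfield L CC \<and> K \<subseteq> L \<and> ring.finite_dimension CC K L \<and>
    {x \<in> L. \<forall>s \<in> carrier (galois_group K L). s x = x} = K"

text \<open>An extension with Galois group \<open>\<int>/n\<int>\<close>, for positive n.\<close>

definition cyclic_extension :: "nat \<Rightarrow> complex set \<Rightarrow> complex set \<Rightarrow> bool"
  where "cyclic_extension n K L \<longleftrightarrow>
    galois_extension K L \<and> galois_group K L \<cong> integer_mod_group n"

text \<open>The smallest Galois extension of K containing S (for a finite set S of numbers algebraic
  over K; otherwise the intersection is over the empty family). When some Galois extension of K
  containing S is abelian, as below, this is just the field generated by K and S.\<close>

definition galois_extension_generated :: "complex set \<Rightarrow> complex set \<Rightarrow> complex set"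
  where "galois_extension_generated K S = \<Inter> {M. galois_extension K M \<and> S \<subseteq> M}"

text \<open>The curve \<open>y\<^sup>2 = x\<^sup>3 + A x + B\<close> with its chord-tangent group law.\<close>

datatype 'a ec_point = Infinity | Affine 'a 'a

definition elliptic_curve_over :: "'a::field set \<Rightarrow> 'a \<Rightarrow> 'a \<Rightarrow> bool"
  where "elliptic_curve_over K A B \<longleftrightarrow> A \<in> K \<and> B \<in> K \<and> 4 * A ^ 3 + 27 * B ^ 2 \<noteq> 0"

definition ec_points :: "'a::field \<Rightarrow> 'a \<Rightarrow> 'a set \<Rightarrow> 'a ec_point set"
  where "ec_points A B L =
    insert Infinity {Affine x y | x y. x \<in> L \<and> y \<in> L \<and> y ^ 2 = x ^ 3 + A * x + B}"

fun ec_neg :: "'a::field ec_point \<Rightarrow> 'a ec_point"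
  where
    "ec_neg Infinity = Infinity"
  | "ec_neg (Affine x y) = Affine x (- y)"

text \<open>In the tangent case, two points of the curve with equal x-coordinates that are not
  opposite coincide and have nonzero y-coordinate. The coefficient B does not enter.\<close>

fun ec_add :: "'a::field \<Rightarrow> 'a ec_point \<Rightarrow> 'a ec_point \<Rightarrow> 'a ec_point"
  where
    "ec_add A Infinity Q = Q"
  | "ec_add A (Affine x1 y1) Infinity = Affine x1 y1"
  | "ec_add A (Affine x1 y1) (Affine x2 y2) =
      (if x1 = x2 \<and> y1 = - y2 then Infinity
       else let l = (if x1 = x2 then (3 * x1 ^ 2 + A) / (2 * y1) else (y2 - y1) / (x2 - x1));
                x3 = l ^ 2 - x1 - x2
            in Affine x3 (l * (x1 - x3) - y1))"

definition ec_mult :: "'a::field \<Rightarrow> int \<Rightarrow> 'a ec_point \<Rightarrow> 'a ec_point"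
  where "ec_mult A m P =
    (if m \<ge> 0 then (ec_add A P ^^ nat m) Infinity
     else ec_neg ((ec_add A P ^^ nat (- m)) Infinity))"

fun ec_coordinates :: "'a ec_point \<Rightarrow> 'a set"
  where
    "ec_coordinates Infinity = {}"
  | "ec_coordinates (Affine x y) = {x, y}"

definition gains_rank :: "complex set \<Rightarrow> complex \<Rightarrow> complex \<Rightarrow> complex set \<Rightarrow> bool"
  where "gains_rank K A B L \<longleftrightarrow>
    (\<exists>P \<in> ec_points A B L. \<forall>m::int. m \<noteq> 0 \<longrightarrow>
      galois_extension_generated K (ec_coordinates (ec_mult A m P)) = L)"

end

theory Submission
  imports Defs
begin

text \<open>
  For a large prime \<open>p\<close>, take a valuation on the complex numbers above \<open>p\<close> and a uniformizer
  \<open>\<pi>\<close> of \<open>K\<close>. One writes down a point \<open>P\<close> over a Kummer extension \<open>L = K(t)\<close> of degree \<open>n\<close> whose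
  parameter \<open>z = x/y\<close> has value \<open>v(\<pi>)/n\<close>; such an \<open>L\<close> is totally ramified above \<open>p\<close>. Near the
  point at infinity, \<open>z(mP) = m z(P) (1 + \<epsilon>)\<close> with \<open>\<epsilon>\<close> of positive value, so the value of \<open>z(mP)\<close>
  still has order \<open>n\<close> modulo the value group of \<open>K\<close>, and \<open>z(mP)\<close> alone generates \<open>L\<close>.

  The estimate for \<open>z(mP)\<close> needs no associativity of the group law. The sequence \<open>z(kP)\<close>,
  \<open>k = 0, 1, 2, \<dots>\<close>, satisfies a recursion with integral coefficients that forces its \<open>i\<close>-th
  differences to be divisible by \<open>z(P)\<^sup>i\<close>, and Newton's forward difference formula gives the claim.

  If there were only finitely many such fields \<open>K(s)\<close>, one could choose \<open>p\<close> such that every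
  generator \<open>s\<close> is a unit above \<open>p\<close>. But if \<open>K(t) = K(s)\<close>, then \<open>t\<close> is a power of \<open>s\<close> times an
  element of \<open>K\<close>, so its value would lie in the value group of \<open>K\<close>.
\<close>

section \<open>Valuation rings\<close>

text \<open>Near the point at infinity x is z^-2 and y is z^-3 up to units, so a z of value
  v(\<pi>)/n forces v(x) = -2 v(\<pi>)/n and v(y) = -3 v(\<pi>)/n. This dictates the shape of the
  explicit points: for n = 3 only x needs a radical, a cube root; for n = 4 x needs a square root
  and y a fourth root; for n = 6 x needs a cube root and y a square root. To control the values, 2,
  3 and the nonzero ones among A and B are made units above p; A = 0 (for n = 3, 6) and B = 0 (for n
  = 4) are separate cases.

  The obstacle is mP with p dividing m: in a bare expansion z(mP) = m z(P) + (higher terms) the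
  error could outweigh m z(P). Newton's formula lets m be factored out at the cost of denominators i
  + 1, and z^i / (i + 1) stays small as soon as p exceeds n times a bound for the ramification of K
  above p.

  That bound is N! with N the degree of K, obtained from integer relations instead of prime ideals.
  The valuation ring is taken in the whole complex field, so one ring serves K and every L, and no
  valuation has to be extended or completed.\<close>

locale valuation_ring =
  fixes V :: "'a::field_char_0 set"
  assumes one_mem [simp]: "1 \<in> V"
    and diff_mem: "x \<in> V \<Longrightarrow> y \<in> V \<Longrightarrow> x - y \<in> V"
    and mult_mem: "x \<in> V \<Longrightarrow> y \<in> V \<Longrightarrow> x * y \<in> V"
    and inverse_mem: "x \<notin> V \<Longrightarrow> inverse x \<in> V"
begin

lemma zero_mem [simp]: "0 \<in> V"
  using diff_mem[OF one_mem one_mem] by simp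

lemma uminus_mem: "x \<in> V \<Longrightarrow> - x \<in> V"
  using diff_mem[OF zero_mem] by fastforce

lemma add_mem: "x \<in> V \<Longrightarrow> y \<in> V \<Longrightarrow> x + y \<in> V"
  using diff_mem[of x "- y"] uminus_mem by simp

lemma power_mem: "x \<in> V \<Longrightarrow> x ^ k \<in> V"
  by (induction k) (auto intro: mult_mem)

lemma of_nat_mem [simp]: "of_nat k \<in> V"
  by (induction k) (auto intro: add_mem)

lemma of_int_mem [simp]: "of_int k \<in> V"
  by (cases k) (auto intro: uminus_mem simp del: of_nat_Suc)

lemma numeral_mem [simp]: "numeral k \<in> V"
  by (metis of_nat_mem of_nat_numeral)

text \<open>With v the valuation of V, \<open>unit x\<close> means v(x) = 0 and
  \<open>small x\<close> means v(x) > 0. Values are compared through \<open>unit (x / y)\<close>, so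
  the value group itself is never formed.\<close>

definition unit :: "'a \<Rightarrow> bool" where
  "unit x \<longleftrightarrow> x \<noteq> 0 \<and> x \<in> V \<and> inverse x \<in> V"

definition small :: "'a \<Rightarrow> bool" where
  "small x \<longleftrightarrow> x \<in> V \<and> \<not> unit x"

lemma small_mem: "small x \<Longrightarrow> x \<in> V"
  by (simp add: small_def)

lemma small_zero [simp]: "small 0"
  by (simp add: small_def unit_def)

lemma unit_one [simp]: "unit 1"
  by (simp add: unit_def)

lemma unit_nonzero: "unit x \<Longrightarrow> x \<noteq> 0"
  and unit_mem: "unit x \<Longrightarrow> x \<in> V"
  by (simp_all add: unit_def)

lemma unit_mult: "unit x \<Longrightarrow> unit y \<Longrightarrow> unit (x * y)"
  by (auto simp: unit_def mult_mem)

lemma unit_inverse: "unit x \<Longrightarrow> unit (inverse x)"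
  by (auto simp: unit_def)

lemma unit_divide: "unit x \<Longrightarrow> unit y \<Longrightarrow> unit (x / y)"
  by (simp add: divide_inverse unit_mult unit_inverse)

lemma unit_power: "unit x \<Longrightarrow> unit (x ^ k)"
  by (induction k) (auto intro: unit_mult)

lemma unit_uminus: "unit x \<Longrightarrow> unit (- x)"
  by (auto simp: unit_def uminus_mem)

lemma unit_power_int: "unit x \<Longrightarrow> unit (x powi k)"
  by (auto simp: power_int_def unit_power unit_inverse)

lemma unit_if_power_unit:
  assumes "unit (x ^ k)" "k > 0"
  shows "unit x"
proof -
  have mem: "y \<in> V" if "y ^ k \<in> V" "y \<noteq> 0" for y
  proof (rule ccontr)
    assume "y \<notin> V"
    \<comment> \<open>y is recovered as y^k (1/y)^(k-1); the second factor lies in V because y is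
      assumed not to.\<close>
    have "y ^ k * inverse y ^ (k - 1) \<in> V"
      by (rule mult_mem[OF that(1) power_mem[OF inverse_mem[OF \<open>y \<notin> V\<close>]]])
    also have "y ^ k * inverse y ^ (k - 1) = y"
      using \<open>y \<noteq> 0\<close> \<open>k > 0\<close> by (cases k) (auto simp: field_simps)
    finally show False using \<open>y \<notin> V\<close> by simp
  qed
  have "x \<noteq> 0"
    using assms by (auto simp: unit_def power_0_left)
  then show ?thesis
    using assms mem[of x] mem[of "inverse x"] by (auto simp: unit_def power_inverse)
qed

lemma not_small_imp_unit: "x \<in> V \<Longrightarrow> \<not> small x \<Longrightarrow> unit x"
  by (simp add: small_def)

lemma small_mult: "small x \<Longrightarrow> y \<in> V \<Longrightarrow> small (x * y)"
proof -
  assume x: "small x" and y: "y \<in> V"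
  have "unit x" if "unit (x * y)"
  proof -
    have "inverse (x * y) * y \<in> V" using that y by (auto simp: unit_def mult_mem)
    then have "inverse x \<in> V" using that by (simp add: unit_def field_simps)
    then show ?thesis using x that by (auto simp: unit_def small_def)
  qed
  then show ?thesis using x y by (auto simp: small_def mult_mem)
qed

lemma small_mult': "small y \<Longrightarrow> x \<in> V \<Longrightarrow> small (x * y)"
  using small_mult[of y x] by (simp add: mult.commute)

lemma small_uminus: "small x \<Longrightarrow> small (- x)"
  using small_mult[of x "-1"] by (simp add: uminus_mem)

text \<open>One of x/y and y/x lies in V, so the summand of smaller value can be factored out with a
  cofactor in V.\<close>

lemma small_add:
  assumes "small x" "small y"
  shows "small (x + y)"
proof (cases "x = 0 \<or> y = 0")
  case False
  have *: "small (x + y)" if "small y" "x / y \<in> V" "y \<noteq> 0" for x y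
  proof -
    have "small (y * (x / y + 1))"
      using that by (intro small_mult add_mem) auto
    then show ?thesis using that by (simp add: distrib_left)
  qed
  show ?thesis
    using *[of y x] *[of x y] assms inverse_mem[of "x / y"] False
    by (cases "x / y \<in> V") (auto simp: add.commute)
qed (use assms in auto)

lemma small_diff: "small x \<Longrightarrow> small y \<Longrightarrow> small (x - y)"
  using small_add[of x "- y"] small_uminus by simp

lemma small_power: "small x \<Longrightarrow> k > 0 \<Longrightarrow> small (x ^ k)"
  by (cases k) (auto intro: small_mult power_mem small_mem)

lemma small_sum: "(\<And>i. i \<in> I \<Longrightarrow> small (f i)) \<Longrightarrow> small (sum f I)"
  by (induction I rule: infinite_finite_induct) (auto intro: small_add)

lemma not_unit_small: "small x \<Longrightarrow> \<not> unit x"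
  by (simp add: small_def)

lemma unit_add_small:
  assumes "unit u" "small x"
  shows "unit (u + x)"
proof (rule ccontr)
  assume "\<not> unit (u + x)"
  then have "small (u + x)"
    using assms by (simp add: small_def unit_mem add_mem)
  then have "small (u + x - x)"
    using assms by (intro small_diff)
  then show False
    using assms by (simp add: small_def)
qed

lemma unit_diff_small: "unit u \<Longrightarrow> small x \<Longrightarrow> unit (u - x)"
  using unit_add_small[of u "- x"] small_uminus by simp

lemma small_if_power_small: "small (x ^ k) \<Longrightarrow> x \<in> V \<Longrightarrow> small x"
  using unit_power[of x k] by (auto simp: small_def)

lemma mem_if_power_mem:
  assumes "x ^ k \<in> V" "k > 0"
  shows "x \<in> V"
proof (rule ccontr)
  assume "x \<notin> V"
  then have s: "small (inverse x)"
    using inverse_mem[of x] by (auto simp: small_def unit_def)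
  have "small (inverse x ^ k * x ^ k)"
    using assms s by (intro small_mult small_power)
  also have "inverse x ^ k * x ^ k = 1"
    using \<open>x \<notin> V\<close> by (auto simp: field_simps)
  finally show False by (simp add: small_def)
qed

lemma small_or_small_inverse:
  "x \<noteq> 0 \<Longrightarrow> unit x \<or> small x \<or> small (inverse x)"
  using inverse_mem[of x] by (auto simp: small_def unit_def)

text \<open>In a vanishing sum the least value is attained twice: divide by a term of least value;
  if all the other quotients were small, the sum would be 1 plus something small, hence nonzero.
  Both the bounded ramification of K and the independence of powers rest on this.\<close>

lemma sum_zero_imp_associated:
  assumes "finite I" "I \<noteq> {}" "\<And>i. i \<in> I \<Longrightarrow> f i \<noteq> 0" "(\<Sum>i\<in>I. f i) = 0"
  obtains i j where "i \<in> I" "j \<in> I" "i \<noteq> j" "unit (f i / f j)"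
proof -
  have "\<exists>j\<in>I. \<forall>i\<in>I. f i / f j \<in> V"
    using assms(1-3)
  proof (induction I rule: finite_ne_induct)
    case (insert a I)
    then obtain j where j: "j \<in> I" "\<forall>i\<in>I. f i / f j \<in> V" by auto
    show ?case
    proof (cases "f a / f j \<in> V")
      case True
      then show ?thesis using j by auto
    next
      case False
      then have ja: "f j / f a \<in> V" using inverse_mem by fastforce
      have "f i / f a \<in> V" if "i \<in> I" for i
      proof -
        have "f i / f j * (f j / f a) \<in> V"
          using j that ja by (intro mult_mem) auto
        then show ?thesis using j insert.prems by simp
      qed
      moreover have "f a / f a \<in> V" using insert.prems by simp
      ultimately show ?thesis by auto
    qed
  qed (auto simp: divide_self_if)
  then obtain j where j: "j \<in> I" "\<forall>i\<in>I. f i / f j \<in> V" by auto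
  have "(\<Sum>i\<in>I. f i / f j) = 0"
    using assms(4) by (simp flip: sum_divide_distrib)
  then have "1 + (\<Sum>i\<in>I - {j}. f i / f j) = 0"
    using j assms by (simp add: sum.remove)
  then have "\<not> small (\<Sum>i\<in>I - {j}. f i / f j)"
    using unit_add_small[OF unit_one] unit_nonzero by metis
  then obtain i where "i \<in> I - {j}" "\<not> small (f i / f j)"
    using small_sum by metis
  then show ?thesis
    using that[of i j] j not_small_imp_unit by auto
qed

text \<open>\<open>divdiff e N f\<close>: the \<open>i\<close>-th differences of \<open>f\<close> lie in \<open>e\<^sup>i V\<close> for \<open>i \<le> N\<close>.\<close>

fun divdiff :: "'a \<Rightarrow> nat \<Rightarrow> (nat \<Rightarrow> 'a) \<Rightarrow> bool" where
  "divdiff e 0 f \<longleftrightarrow> (\<forall>k. f k \<in> V)"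
| "divdiff e (Suc N) f \<longleftrightarrow>
     (\<forall>k. f k \<in> V) \<and> (\<exists>g. divdiff e N g \<and> (\<forall>k. f (Suc k) = f k + e * g k))"

lemma divdiff_mem: "divdiff e N f \<Longrightarrow> f k \<in> V"
  by (cases N) auto

lemma divdiff_SucD: "divdiff e (Suc N) f \<Longrightarrow> divdiff e N f"
proof (induction N arbitrary: f)
  case (Suc N)
  then show ?case by (metis divdiff.simps(2))
qed auto

lemma divdiff_const: "c \<in> V \<Longrightarrow> divdiff e N (\<lambda>k. c)"
proof (induction N arbitrary: c)
  case (Suc N)
  then show ?case by (auto intro!: exI[of _ "\<lambda>k. 0"])
qed auto

lemma divdiff_add: "divdiff e N f \<Longrightarrow> divdiff e N g \<Longrightarrow> divdiff e N (\<lambda>k. f k + g k)"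
proof (induction N arbitrary: f g)
  case (Suc N)
  from Suc.prems obtain f' g' where
    "divdiff e N f'" "\<forall>k. f (Suc k) = f k + e * f' k"
    "divdiff e N g'" "\<forall>k. g (Suc k) = g k + e * g' k" by auto
  then show ?case
    using Suc by (auto intro!: exI[of _ "\<lambda>k. f' k + g' k"] add_mem simp: algebra_simps)
qed (auto intro: add_mem)

lemma divdiff_mult:
  assumes "e \<in> V"
  shows "divdiff e N f \<Longrightarrow> divdiff e N g \<Longrightarrow> divdiff e N (\<lambda>k. f k * g k)"
proof (induction N arbitrary: f g)
  case (Suc N)
  from Suc.prems obtain f' g' where *:
    "divdiff e N f'" "\<forall>k. f (Suc k) = f k + e * f' k"
    "divdiff e N g'" "\<forall>k. g (Suc k) = g k + e * g' k" by auto
  \<comment> \<open>The discrete Leibniz rule after division by e. The product of the two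
    differences keeps one factor e, which is where e must lie in V.\<close>
  have "divdiff e N (\<lambda>k. f' k * g k + (f k * g' k + e * (f' k * g' k)))"
    using Suc.prems[THEN divdiff_SucD] * assms
    by (intro divdiff_add Suc.IH divdiff_const)
  then show ?case
    using Suc.prems * by (auto intro!: exI mult_mem simp: algebra_simps)
qed (auto intro: mult_mem)

lemma divdiff_inverse:
  assumes "e \<in> V" "divdiff e N f" "\<And>k. unit (f k)"
  shows "divdiff e N (\<lambda>k. inverse (f k))"
  using assms(2,3)
proof (induction N arbitrary: f)
  case (Suc N)
  from Suc.prems obtain f' where *:
    "divdiff e N f'" "\<forall>k. f (Suc k) = f k + e * f' k" by auto
  have "divdiff e N (\<lambda>k. f k + e * f' k)"
    using Suc.prems(1)[THEN divdiff_SucD] * assms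
    by (intro divdiff_add divdiff_mult divdiff_const)
  then have "divdiff e N (\<lambda>k. f (Suc k))" using * by simp
  moreover have "unit (f k + e * f' k)" for k
    using Suc.prems(2)[of "Suc k"] * by simp
  \<comment> \<open>The divided difference of 1/f is -f' / (f(k) f(k+1)). The shifted sequence f + e
    f' has units as values, so the induction hypothesis covers its inverse too.\<close>
  ultimately have "divdiff e N (\<lambda>k. - 1 * f' k * (inverse (f k) * inverse (f (Suc k))))"
    using Suc.prems Suc.prems(1)[THEN divdiff_SucD] * assms
    by (intro divdiff_mult divdiff_const Suc.IH) (auto intro: uminus_mem simp del: divdiff.simps)
  moreover have "inverse (f (Suc k)) = inverse (f k) +
      e * (- 1 * f' k * (inverse (f k) * inverse (f (Suc k))))" for k
  proof -
    have "f k \<noteq> 0" "f (Suc k) \<noteq> 0"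
      using Suc.prems(2) unit_nonzero by blast+
    moreover have "e * (- 1 * f' k * q) = (f k - f (Suc k)) * q" for q
      using *(2) by (simp add: algebra_simps)
    moreover have "inverse b = inverse a + (a - b) * (inverse a * inverse b)"
      if "a \<noteq> 0" "b \<noteq> 0" for a b :: 'a
      using that by (simp add: field_simps)
    ultimately show ?thesis by metis
  qed
  ultimately show ?case
    using Suc.prems by (auto simp: unit_def)
qed (auto simp: unit_def)

lemma divdiff_newton:
  assumes "\<And>N. divdiff e N f"
  obtains h where "\<And>i. h i \<in> V" "\<And>k. k \<le> N \<Longrightarrow> f k = (\<Sum>i\<le>N. of_nat (k choose i) * e ^ i * h i)"
proof -
  have "\<exists>h. (\<forall>i. h i \<in> V) \<and> (\<forall>k\<le>N. f k = (\<Sum>i\<le>N. of_nat (k choose i) * e ^ i * h i))"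
    using assms[of N]
  proof (induction N arbitrary: f)
    case 0
    then show ?case by (auto intro!: exI[of _ f])
  next
    case (Suc N)
    from Suc.prems obtain g where g: "divdiff e N g" "\<forall>k. f (Suc k) = f k + e * g k" by auto
    from Suc.IH[OF g(1)] obtain h where h: "\<forall>i. h i \<in> V"
      "\<forall>k\<le>N. g k = (\<Sum>i\<le>N. of_nat (k choose i) * e ^ i * h i)" by auto
    \<comment> \<open>The Newton coefficients of f are f 0 followed by those of its divided
      difference g; Pascal's rule then carries the formula from k to k + 1.\<close>
    define h' where "h' = case_nat (f 0) h"
    have "f k = (\<Sum>i\<le>Suc N. of_nat (k choose i) * e ^ i * h' i)" if "k \<le> Suc N" for k
      using that
    proof (induction k)
      case 0
      have "(\<Sum>i\<le>Suc N. of_nat (0 choose i) * e ^ i * h' i) = h' 0"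
        by (subst sum.atMost_Suc_shift) simp
      then show ?case by (simp add: h'_def)
    next
      case (Suc k)
      have "(\<Sum>i\<le>Suc N. of_nat (Suc k choose i) * e ^ i * h' i) =
          h' 0 + (\<Sum>i\<le>N. of_nat (k choose i) * e ^ Suc i * h i) +
            (\<Sum>i\<le>N. of_nat (k choose Suc i) * e ^ Suc i * h' (Suc i))"
        by (subst sum.atMost_Suc_shift)
          (simp add: h'_def algebra_simps sum.distrib del: power_Suc)
      also have "(\<Sum>i\<le>N. of_nat (k choose i) * e ^ Suc i * h i) = e * g k"
        using h Suc.prems by (simp add: sum_distrib_left algebra_simps)
      also have "h' 0 + e * g k + (\<Sum>i\<le>N. of_nat (k choose Suc i) * e ^ Suc i * h' (Suc i)) =
          e * g k + (\<Sum>i\<le>Suc N. of_nat (k choose i) * e ^ i * h' i)"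
        unfolding sum.atMost_Suc_shift by simp
      also have "\<dots> = e * g k + f k" using Suc by simp
      finally show ?case using g by simp
    qed
    moreover have "h' i \<in> V" for i
      using h Suc.prems by (cases i) (auto simp: h'_def divdiff_mem)
    ultimately show ?case by blast
  qed
  then show ?thesis using that by blast
qed

text \<open>The quotients \<open>e\<^sup>i / (i + 1)\<close> are the coefficients of a logarithm: their smallness makes
  the linear term dominate.\<close>

lemma divdiff_linear_term_dominates:
  assumes "\<And>N. divdiff e N f" "f 0 = 0" "f 1 = e" "e \<noteq> 0"
    and small: "\<And>i. i > 0 \<Longrightarrow> small (e ^ i / of_nat (Suc i))"
    and "k > 0"
  shows "unit (f k / (of_nat k * e))"
proof -
  from divdiff_newton[OF assms(1), where N = k] obtain h where h: "\<And>i. h i \<in> V"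
    "\<And>j. j \<le> k \<Longrightarrow> f j = (\<Sum>i\<le>k. of_nat (j choose i) * e ^ i * h i)" by metis
  obtain l where l: "k = Suc l" using \<open>k > 0\<close> gr0_conv_Suc by auto
  have "h 0 = 0"
    using h(2)[of 0] assms(2) unfolding l sum.atMost_Suc_shift by simp
  have "e * h 1 = e"
    using h(2)[of 1] assms(3) \<open>h 0 = 0\<close> \<open>k > 0\<close> unfolding l sum.atMost_Suc_shift
    by (cases l) (auto simp: sum.atMost_Suc_shift simp del: sum.atMost_Suc)
  then have "h 1 = 1" using \<open>e \<noteq> 0\<close> by simp
  have "f k = (\<Sum>i\<le>l. of_nat (k choose Suc i) * e ^ Suc i * h (Suc i))"
    using h(2)[of k] \<open>h 0 = 0\<close> unfolding l sum.atMost_Suc_shift by simp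
  also have "\<dots> = (\<Sum>i\<le>l. of_nat k * e * (of_nat (l choose i) * (e ^ i / of_nat (Suc i)) * h (Suc i)))"
  proof (intro sum.cong refl)
    fix i
    \<comment> \<open>This pulls the factor k out of every term at the price of the denominator i +
      1; the estimate therefore survives when p divides k.\<close>
    have "of_nat (Suc i) * of_nat (k choose Suc i) = (of_nat k * of_nat (l choose i) :: 'a)"
      unfolding l of_nat_mult [symmetric] by (metis Suc_times_binomial)
    then have "of_nat (k choose Suc i) = (of_nat k * of_nat (l choose i) / of_nat (Suc i) :: 'a)"
      by (simp add: field_simps del: of_nat_Suc)
    then show "of_nat (k choose Suc i) * e ^ Suc i * h (Suc i) =
      of_nat k * e * (of_nat (l choose i) * (e ^ i / of_nat (Suc i)) * h (Suc i))"
      by (simp add: field_simps del: of_nat_Suc)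
  qed
  finally have "f k / (of_nat k * e) = (\<Sum>i\<le>l. of_nat (l choose i) * (e ^ i / of_nat (Suc i)) * h (Suc i))"
    using \<open>k > 0\<close> \<open>e \<noteq> 0\<close> unfolding sum_distrib_left [symmetric] by simp
  also have "\<dots> = 1 + (\<Sum>i\<in>{..l} - {0}. of_nat (l choose i) * (e ^ i / of_nat (Suc i)) * h (Suc i))"
    using \<open>h 1 = 1\<close> by (subst sum.remove[of _ 0]) auto
  also have "unit \<dots>"
    using h(1) by (intro unit_add_small unit_one small_sum small_mult small_mult'[OF small]) auto
  finally show ?thesis .
qed

end

section \<open>The addition law near the point at infinity\<close>

definition ec_curve :: "'a::field \<Rightarrow> 'a \<Rightarrow> 'a ec_point set" where
  "ec_curve A B = ec_points A B UNIV"

text \<open>An affine point with y = 0 gets z = w = 0 through division by zero, just like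
  \<open>Infinity\<close>. Such points are not in this chart, so the lemmas below carry the
  condition that y is nonzero.\<close>

fun zcoord :: "'a::field ec_point \<Rightarrow> 'a" where
  "zcoord Infinity = 0"
| "zcoord (Affine x y) = x / y"

fun wcoord :: "'a::field ec_point \<Rightarrow> 'a" where
  "wcoord Infinity = 0"
| "wcoord (Affine x y) = 1 / y"

text \<open>In the coordinates \<open>z = x/y\<close>, \<open>w = 1/y\<close> the curve is \<open>w = z\<^sup>3 + A z w\<^sup>2 + B w\<^sup>3\<close>, with the
  point at infinity at the origin. Subtracting two such equations gives a formula for the slope of
  the chord that also covers the tangent, and whose denominator is a unit near the origin.\<close>

definition chord_num :: "'a::field \<Rightarrow> 'a \<Rightarrow> 'a \<Rightarrow> 'a \<Rightarrow> 'a \<Rightarrow> 'a" where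
  "chord_num A z1 w1 z2 w2 = z1\<^sup>2 + z1 * z2 + z2\<^sup>2 + A * w2\<^sup>2"

definition chord_den :: "'a::field \<Rightarrow> 'a \<Rightarrow> 'a \<Rightarrow> 'a \<Rightarrow> 'a \<Rightarrow> 'a \<Rightarrow> 'a" where
  "chord_den A B z1 w1 z2 w2 = 1 - A * z1 * (w1 + w2) - B * (w1\<^sup>2 + w1 * w2 + w2\<^sup>2)"

definition chord_slope :: "'a::field \<Rightarrow> 'a \<Rightarrow> 'a \<Rightarrow> 'a \<Rightarrow> 'a \<Rightarrow> 'a \<Rightarrow> 'a" where
  "chord_slope A B z1 w1 z2 w2 = chord_num A z1 w1 z2 w2 * inverse (chord_den A B z1 w1 z2 w2)"

text \<open>The line y = l x + c reads w = 1/c - (l/c) z in the other chart. The identity says that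
  \<open>chord_num\<close> / \<open>chord_den\<close> is -l/c, with denominators cleared.
  Eliminating A and B by Vieta's relations makes it a polynomial identity, valid for chords and
  tangents alike.\<close>

lemma vieta_chord_den:
  fixes x1 x2 l c A B :: "'a::field_char_0"
  assumes "y1 = l * x1 + c" "y2 = l * x2 + c" "x3 = l\<^sup>2 - x1 - x2"
    and "x1 * x2 + (x1 + x2) * x3 = A - 2 * l * c" "x1 * x2 * x3 = c\<^sup>2 - B"
  shows "c * (x1\<^sup>2 * y2\<^sup>2 + x1 * x2 * y1 * y2 + x2\<^sup>2 * y1\<^sup>2 + A * y1\<^sup>2) =
    - l * (y1\<^sup>2 * y2\<^sup>2 - A * x1 * y2 * (y1 + y2) - B * (y1\<^sup>2 + y1 * y2 + y2\<^sup>2))"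
proof -
  have A: "A = x1 * x2 + (x1 + x2) * x3 + 2 * l * c" and B: "B = c\<^sup>2 - x1 * x2 * x3"
    using assms(4,5) by (simp_all add: algebra_simps)
  show ?thesis
    unfolding A B assms(1-3) by (simp add: power2_eq_square power3_eq_cube algebra_simps)
qed

text \<open>The product of the y-coordinates is c^3 times \<open>cubic_lead\<close> at the slope
  -l/c, and the second expression divided by that product is the sum of the three z-coordinates. The
  third part puts the third point of the line on the curve.\<close>

lemma vieta_prod:
  fixes x1 x2 l c A B :: "'a::field_char_0"
  assumes "y1 = l * x1 + c" "y2 = l * x2 + c" "y3 = l * x3 + c" "x3 = l\<^sup>2 - x1 - x2"
    and "x1 * x2 + (x1 + x2) * x3 = A - 2 * l * c" "x1 * x2 * x3 = c\<^sup>2 - B"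
  shows "y1 * y2 * y3 = c ^ 3 + A * c * l\<^sup>2 - B * l ^ 3"
    and "x1 * y2 * y3 + x2 * y1 * y3 + x3 * y1 * y2 = 2 * A * l * c - 3 * B * l\<^sup>2"
    and "y3\<^sup>2 = x3 ^ 3 + A * x3 + B"
proof -
  have A: "A = x1 * x2 + (x1 + x2) * x3 + 2 * l * c" and B: "B = c\<^sup>2 - x1 * x2 * x3"
    using assms(5,6) by (simp_all add: algebra_simps)
  show "y1 * y2 * y3 = c ^ 3 + A * c * l\<^sup>2 - B * l ^ 3"
    unfolding A B assms(1-4) by (simp add: power2_eq_square power3_eq_cube algebra_simps)
  show "x1 * y2 * y3 + x2 * y1 * y3 + x3 * y1 * y2 = 2 * A * l * c - 3 * B * l\<^sup>2"
    unfolding A B assms(1-4) by (simp add: power2_eq_square power3_eq_cube algebra_simps)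
  show "y3\<^sup>2 = x3 ^ 3 + A * x3 + B"
    unfolding A B assms(1-4) by (simp add: power2_eq_square power3_eq_cube algebra_simps)
qed

definition chord_icpt :: "'a::field \<Rightarrow> 'a \<Rightarrow> 'a \<Rightarrow> 'a \<Rightarrow> 'a \<Rightarrow> 'a \<Rightarrow> 'a" where
  "chord_icpt A B z1 w1 z2 w2 = w1 - chord_slope A B z1 w1 z2 w2 * z1"

text \<open>The leading coefficient of the cubic that cuts out the points of the curve on a line of
  slope \<open>s\<close>.\<close>

definition cubic_lead :: "'a::field \<Rightarrow> 'a \<Rightarrow> 'a \<Rightarrow> 'a" where
  "cubic_lead A B s = 1 + A * s\<^sup>2 + B * s ^ 3"

text \<open>Substituting w = s z + i into the curve gives a cubic in z whose three roots sum to -(2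
  A s + 3 B s^2) i / \<open>cubic_lead A B s\<close>. The third point of the line is -(P + Q), and
  negation changes the sign of both z and w.\<close>

definition z_sum :: "'a::field \<Rightarrow> 'a \<Rightarrow> 'a \<Rightarrow> 'a \<Rightarrow> 'a \<Rightarrow> 'a \<Rightarrow> 'a" where
  "z_sum A B z1 w1 z2 w2 = (let s = chord_slope A B z1 w1 z2 w2 in
     z1 + z2 + (2 * A * s + 3 * B * s\<^sup>2) * chord_icpt A B z1 w1 z2 w2 * inverse (cubic_lead A B s))"

definition w_sum :: "'a::field \<Rightarrow> 'a \<Rightarrow> 'a \<Rightarrow> 'a \<Rightarrow> 'a \<Rightarrow> 'a \<Rightarrow> 'a" where
  "w_sum A B z1 w1 z2 w2 =
     chord_slope A B z1 w1 z2 w2 * z_sum A B z1 w1 z2 w2 - chord_icpt A B z1 w1 z2 w2"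

lemma zw_sum_affine:
  fixes x1 x2 l c A B :: "'a::field_char_0"
  assumes y: "y1 = l * x1 + c" "y2 = l * x2 + c" "y3 = l * x3 + c" "x3 = l\<^sup>2 - x1 - x2"
    and vieta: "x1 * x2 + (x1 + x2) * x3 = A - 2 * l * c" "x1 * x2 * x3 = c\<^sup>2 - B"
    and nz: "y1 \<noteq> 0" "y2 \<noteq> 0" "chord_den A B (x1 / y1) (1 / y1) (x2 / y2) (1 / y2) \<noteq> 0"
      "cubic_lead A B (chord_slope A B (x1 / y1) (1 / y1) (x2 / y2) (1 / y2)) \<noteq> 0"
  shows "y3 \<noteq> 0" "z_sum A B (x1 / y1) (1 / y1) (x2 / y2) (1 / y2) = - x3 / y3"
    "w_sum A B (x1 / y1) (1 / y1) (x2 / y2) (1 / y2) = - 1 / y3"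
proof -
  define D where "D = chord_den A B (x1 / y1) (1 / y1) (x2 / y2) (1 / y2)"
  define N where "N = chord_num A (x1 / y1) (1 / y1) (x2 / y2) (1 / y2)"
  define s where "s = chord_slope A B (x1 / y1) (1 / y1) (x2 / y2) (1 / y2)"
  define i where "i = chord_icpt A B (x1 / y1) (1 / y1) (x2 / y2) (1 / y2)"
  have N: "N * (y1\<^sup>2 * y2\<^sup>2) = x1\<^sup>2 * y2\<^sup>2 + x1 * x2 * y1 * y2 + x2\<^sup>2 * y1\<^sup>2 + A * y1\<^sup>2"
    using nz by (simp add: N_def chord_num_def field_simps power2_eq_square)
  have D: "D * (y1\<^sup>2 * y2\<^sup>2) = y1\<^sup>2 * y2\<^sup>2 - A * x1 * y2 * (y1 + y2) - B * (y1\<^sup>2 + y1 * y2 + y2\<^sup>2)"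
    using nz by (simp add: D_def chord_den_def field_simps power2_eq_square)
  have "(c * N) * (y1\<^sup>2 * y2\<^sup>2) = (- l * D) * (y1\<^sup>2 * y2\<^sup>2)"
    using vieta_chord_den[OF y(1,2,4) vieta] N D by (simp only: mult.assoc)
  moreover have "y1\<^sup>2 * y2\<^sup>2 \<noteq> 0"
    using nz by simp
  ultimately have cN: "c * N = - l * D"
    using mult_right_cancel by blast
  have "D \<noteq> 0" using nz by (simp add: D_def)
  \<comment> \<open>If c = 0, then l D = 0, hence l = 0 and y1 = 0. So the line avoids the origin of
    the xy-plane and is not vertical in the zw-plane.\<close>
  have "c \<noteq> 0"
  proof
    assume "c = 0"
    then show False using cN y nz \<open>D \<noteq> 0\<close> by auto
  qed
  have s: "s = - l / c"
    using cN \<open>c \<noteq> 0\<close> \<open>D \<noteq> 0\<close>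
    by (simp add: s_def chord_slope_def N_def [symmetric] D_def [symmetric] field_simps)
  have "i = (l * x1 + c) / (c * y1)"
    using \<open>c \<noteq> 0\<close> nz(1) unfolding i_def chord_icpt_def s_def [symmetric] s
    by (simp add: field_simps)
  then have i: "i = 1 / c"
    using nz(1) by (simp add: y(1))
  define q where "q = cubic_lead A B s"
  have q: "c ^ 3 * q = y1 * y2 * y3"
    unfolding vieta_prod(1)[OF y vieta] q_def cubic_lead_def s using \<open>c \<noteq> 0\<close>
    by (simp add: field_simps power2_eq_square power3_eq_cube)
  have "q \<noteq> 0" using nz by (simp add: q_def s_def)
  then show y3: "y3 \<noteq> 0" using q \<open>c \<noteq> 0\<close> by auto
  have "(2 * A * s + 3 * B * s\<^sup>2) * i * c ^ 3 = - (2 * A * l * c - 3 * B * l\<^sup>2)"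
    unfolding s i using \<open>c \<noteq> 0\<close> by (simp add: field_simps power2_eq_square power3_eq_cube)
  also have "\<dots> = - (x1 * y2 * y3 + x2 * y1 * y3 + x3 * y1 * y2)"
    unfolding vieta_prod(2)[OF y vieta] ..
  finally have e: "(2 * A * s + 3 * B * s\<^sup>2) * i * c ^ 3 = - (x1 * y2 * y3 + x2 * y1 * y3 + x3 * y1 * y2)" .
  have "(2 * A * s + 3 * B * s\<^sup>2) * i * inverse q = ((2 * A * s + 3 * B * s\<^sup>2) * i * c ^ 3) / (c ^ 3 * q)"
    using \<open>q \<noteq> 0\<close> \<open>c \<noteq> 0\<close> by (simp add: field_simps)
  also have "\<dots> = - (x1 / y1 + x2 / y2 + x3 / y3)"
    unfolding e q using nz y3 by (simp add: field_simps)
  finally show z: "z_sum A B (x1 / y1) (1 / y1) (x2 / y2) (1 / y2) = - x3 / y3"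
    unfolding z_sum_def Let_def s_def [symmetric] i_def [symmetric] q_def [symmetric] by simp
  show "w_sum A B (x1 / y1) (1 / y1) (x2 / y2) (1 / y2) = - 1 / y3"
    unfolding w_sum_def s_def [symmetric] i_def [symmetric] z s i using y3 \<open>c \<noteq> 0\<close>
    by (simp add: field_simps) (simp add: y(3) algebra_simps)
qed

lemma zw_equation:
  assumes "P \<in> ec_curve A B" "\<forall>x y. P = Affine x y \<longrightarrow> y \<noteq> 0"
  shows "wcoord P = zcoord P ^ 3 + A * zcoord P * wcoord P ^ 2 + B * wcoord P ^ 3"
proof (cases P)
  case (Affine x y)
  then have "y \<noteq> 0" "y\<^sup>2 = x ^ 3 + A * x + B"
    using assms by (auto simp: ec_curve_def ec_points_def)
  moreover have "1 / y = y\<^sup>2 / y ^ 3"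
    using \<open>y \<noteq> 0\<close> by (simp add: field_simps power2_eq_square power3_eq_cube)
  ultimately have "1 / y = (x ^ 3 + A * x + B) / y ^ 3" by simp
  also have "\<dots> = (x / y) ^ 3 + A * (x / y) * (1 / y)\<^sup>2 + B * (1 / y) ^ 3"
    by (simp add: add_divide_distrib power2_eq_square power3_eq_cube)
  finally show ?thesis by (simp add: Affine)
qed auto

text \<open>One formula has to be matched with every branch of \<open>ec_add\<close>: Q at infinity,
  Q = -P, tangent and chord. Nonvanishing denominators are left as hypotheses; smallness supplies
  them later.\<close>

lemma ec_add_zw:
  fixes A B :: "'a::field_char_0"
  assumes "P \<in> ec_curve A B" "Q \<in> ec_curve A B" "P = Affine x1 y1" "y1 \<noteq> 0"
    and "\<forall>x y. Q = Affine x y \<longrightarrow> y \<noteq> 0"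
    and D: "chord_den A B (zcoord P) (wcoord P) (zcoord Q) (wcoord Q) \<noteq> 0"
    and L: "cubic_lead A B (chord_slope A B (zcoord P) (wcoord P) (zcoord Q) (wcoord Q)) \<noteq> 0"
  shows "ec_add A P Q \<in> ec_curve A B"
    and "\<forall>x y. ec_add A P Q = Affine x y \<longrightarrow> y \<noteq> 0"
    and "zcoord (ec_add A P Q) = z_sum A B (zcoord P) (wcoord P) (zcoord Q) (wcoord Q)"
    and "wcoord (ec_add A P Q) = w_sum A B (zcoord P) (wcoord P) (zcoord Q) (wcoord Q)"
proof -
  have c1: "y1\<^sup>2 = x1 ^ 3 + A * x1 + B"
    using assms(1,3) by (auto simp: ec_curve_def ec_points_def)
  have "ec_add A P Q \<in> ec_curve A B \<and> (\<forall>x y. ec_add A P Q = Affine x y \<longrightarrow> y \<noteq> 0) \<and>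
    zcoord (ec_add A P Q) = z_sum A B (zcoord P) (wcoord P) (zcoord Q) (wcoord Q) \<and>
    wcoord (ec_add A P Q) = w_sum A B (zcoord P) (wcoord P) (zcoord Q) (wcoord Q)"
  proof -
    define z w where "z = zcoord P" and "w = wcoord P"
    have zw: "w = z ^ 3 + A * z * w ^ 2 + B * w ^ 3"
      unfolding z_def w_def using assms(1,3,4) by (intro zw_equation) auto
    have "w \<noteq> 0" using assms by (simp add: w_def)
    show ?thesis
    proof (cases Q)
      case Infinity
      \<comment> \<open>Here, and for Q = -P below, the line passes through the origin: its
        intercept is 0, so \<open>z_sum\<close> reduces to z1 + z2.\<close>
      have "w * chord_den A B z w 0 0 = z ^ 3"
        using zw by (simp add: chord_den_def algebra_simps power2_eq_square power3_eq_cube)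
      moreover have "chord_den A B z w 0 0 \<noteq> 0"
        using D by (simp add: Infinity z_def w_def)
      ultimately have "z \<noteq> 0" "chord_slope A B z w 0 0 * z = w"
        using \<open>w \<noteq> 0\<close>
        by (auto simp: chord_slope_def chord_num_def field_simps power2_eq_square power3_eq_cube)
      then show ?thesis
        using assms(1,3,4) unfolding z_def [symmetric] w_def [symmetric]
        by (simp add: Infinity z_sum_def w_sum_def chord_icpt_def z_def w_def)
    next
      case (Affine x2 y2)
      have y2: "y2 \<noteq> 0" and c2: "y2\<^sup>2 = x2 ^ 3 + A * x2 + B"
        using assms(2,5) Affine by (auto simp: ec_curve_def ec_points_def)
      show ?thesis
      proof (cases "x1 = x2 \<and> y1 = - y2")
        case True
        have Q: "zcoord Q = - z" "wcoord Q = - w"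
          using True by (simp_all add: Affine z_def w_def assms(3))
        have "z * chord_num A z w (- z) (- w) = w * chord_den A B z w (- z) (- w)"
          using zw by (simp add: chord_num_def chord_den_def algebra_simps power2_eq_square power3_eq_cube)
        then have "chord_slope A B z w (- z) (- w) * z = w"
          using D by (simp add: Q z_def [symmetric] w_def [symmetric] chord_slope_def field_simps)
        then show ?thesis
          unfolding z_def [symmetric] w_def [symmetric] Q
          using True by (simp add: Affine assms(3) z_sum_def w_sum_def chord_icpt_def ec_curve_def ec_points_def)
      next
        case False
        define l where "l = (if x1 = x2 then (3 * x1 ^ 2 + A) / (2 * y1) else (y2 - y1) / (x2 - x1))"
        define x3 where "x3 = l ^ 2 - x1 - x2"
        define c where "c = y1 - l * x1"
        have sum: "ec_add A P Q = Affine x3 (l * (x1 - x3) - y1)"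
          using False by (simp add: assms(3) Affine Let_def l_def x3_def)
        have y1': "y1 = l * x1 + c"
          by (simp add: c_def)
        \<comment> \<open>From here on tangent and chord are treated alike, through Vieta's
          relations for the line y = l x + c.\<close>
        have y2': "y2 = l * x2 + c" and v2: "x1 * x2 + (x1 + x2) * x3 = A - 2 * l * c"
        proof (atomize (full), cases "x1 = x2")
          case True
          then have "(y1 - y2) * (y1 + y2) = 0"
            using c1 c2 by (simp add: algebra_simps power2_eq_square)
          then have "y1 = y2" using False True by (auto simp: add_eq_0_iff)
          have l: "l * (2 * y1) = 3 * x1 ^ 2 + A"
            using True assms(4) by (simp add: l_def)
          have "x1 * x2 + (x1 + x2) * x3 = A - 2 * l * c"
            unfolding True [symmetric] x3_def c_def using l
            by (simp add: algebra_simps power2_eq_square)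
          then show "y2 = l * x2 + c \<and> x1 * x2 + (x1 + x2) * x3 = A - 2 * l * c"
            using True \<open>y1 = y2\<close> y1' by simp
        next
          case ne: False
          then have "l * (x2 - x1) = y2 - y1"
            by (simp add: l_def)
          then have y2': "y2 = l * x2 + c"
            by (simp add: c_def algebra_simps)
          have "(l * x2 + c)\<^sup>2 - (l * x1 + c)\<^sup>2 = (x2 - x1) * (x1\<^sup>2 + x1 * x2 + x2\<^sup>2 + A)"
            using c1 c2 unfolding y1' [symmetric] y2' [symmetric]
            by (simp add: algebra_simps power2_eq_square power3_eq_cube)
          then have "(x2 - x1) * (l\<^sup>2 * (x1 + x2) + 2 * l * c) = (x2 - x1) * (x1\<^sup>2 + x1 * x2 + x2\<^sup>2 + A)"
            by (simp add: algebra_simps power2_eq_square)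
          then have "l\<^sup>2 * (x1 + x2) + 2 * l * c = x1\<^sup>2 + x1 * x2 + x2\<^sup>2 + A"
            using ne by simp
          then have "x1 * x2 + (x1 + x2) * x3 = A - 2 * l * c"
            unfolding x3_def by (simp add: algebra_simps power2_eq_square)
          then show "y2 = l * x2 + c \<and> x1 * x2 + (x1 + x2) * x3 = A - 2 * l * c"
            using y2' by simp
        qed
        have "x3 = l\<^sup>2 - x1 - x2"
          by (simp add: x3_def)
        then have l2: "l\<^sup>2 = x1 + x2 + x3"
          by simp
        have A: "A = x1 * x2 + (x1 + x2) * x3 + 2 * l * c"
          using v2 by simp
        have "c\<^sup>2 - B = x1 ^ 3 + A * x1 - (x1 + x2 + x3) * x1\<^sup>2 - 2 * l * c * x1"
          using c1 unfolding y1' l2 [symmetric] by (simp add: algebra_simps power2_eq_square)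
        also have "\<dots> = x1 * x2 * x3"
          unfolding A by (simp add: algebra_simps power2_eq_square power3_eq_cube)
        finally have v3: "x1 * x2 * x3 = c\<^sup>2 - B" by simp
        define y3 where "y3 = l * x3 + c"
        have sum': "ec_add A P Q = Affine x3 (- y3)"
          unfolding sum y3_def c_def by (simp add: algebra_simps)
        have "y3\<^sup>2 = x3 ^ 3 + A * x3 + B"
          by (rule vieta_prod(3)[OF y1' y2' y3_def x3_def v2 v3])
        moreover note zw_sum_affine[OF y1' y2' y3_def x3_def v2 v3 assms(4) y2]
        ultimately show ?thesis
          using D L unfolding sum' by (simp add: ec_curve_def ec_points_def assms(3) Affine)
      qed
    qed
  qed
  then show "ec_add A P Q \<in> ec_curve A B"
    and "\<forall>x y. ec_add A P Q = Affine x y \<longrightarrow> y \<noteq> 0"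
    and "zcoord (ec_add A P Q) = z_sum A B (zcoord P) (wcoord P) (zcoord Q) (wcoord Q)"
    and "wcoord (ec_add A P Q) = w_sum A B (zcoord P) (wcoord P) (zcoord Q) (wcoord Q)"
    by auto
qed

text \<open>The difference of the two curve equations factors as (w2 - w1) \<open>chord_den\<close>
  - (z2 - z1) \<open>chord_num\<close>. This justifies the name of
  \<open>chord_slope\<close>.\<close>

lemma zw_chord:
  fixes z1 w1 z2 w2 :: "'a::field_char_0"
  assumes "w1 = z1 ^ 3 + A * z1 * w1 ^ 2 + B * w1 ^ 3" "w2 = z2 ^ 3 + A * z2 * w2 ^ 2 + B * w2 ^ 3"
    and "chord_den A B z1 w1 z2 w2 \<noteq> 0"
  shows "w2 = chord_slope A B z1 w1 z2 w2 * z2 + chord_icpt A B z1 w1 z2 w2"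
proof -
  have "(w2 - w1) * chord_den A B z1 w1 z2 w2 - (z2 - z1) * chord_num A z1 w1 z2 w2 =
      (w2 - (z2 ^ 3 + A * z2 * w2 ^ 2 + B * w2 ^ 3)) - (w1 - (z1 ^ 3 + A * z1 * w1 ^ 2 + B * w1 ^ 3))"
    by (simp add: chord_den_def chord_num_def power2_eq_square power3_eq_cube algebra_simps)
  also have "\<dots> = 0" using assms(1,2) by simp
  finally have "w2 - w1 = (z2 - z1) * chord_slope A B z1 w1 z2 w2"
    using assms(3) by (simp add: chord_slope_def field_simps)
  then show ?thesis by (simp add: chord_icpt_def algebra_simps)
qed

section \<open>Multiples of a point close to the origin of the zw-plane\<close>

context valuation_ring
begin

lemma unit_chord_den:
  assumes "A \<in> V" "B \<in> V" "small z1" "small w1" "small z2" "small w2"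
  shows "unit (chord_den A B z1 w1 z2 w2)"
  unfolding chord_den_def using assms
  by (intro unit_diff_small unit_one small_mult' small_add small_power) (auto intro: mult_mem small_mem)

lemma small_chord_slope:
  assumes "A \<in> V" "B \<in> V" "small z1" "small w1" "small z2" "small w2"
  shows "small (chord_slope A B z1 w1 z2 w2)"
  unfolding chord_slope_def chord_num_def using assms unit_chord_den[OF assms]
  by (intro small_mult[where y = "inverse _"] small_mult' small_add small_power) (auto simp: unit_def intro: small_mem)

lemma unit_cubic_lead:
  assumes "A \<in> V" "B \<in> V" "small s"
  shows "unit (cubic_lead A B s)"
  unfolding cubic_lead_def using assms
  by (intro unit_add_small unit_one small_mult' small_power) auto

text \<open>The region where z and w are small is stable under adding P and makes all denominators
  units, so the addition formula applies at every step. The induction has to carry the curve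
  equation, y nonzero and smallness together.\<close>

lemma multiples_near_infinity:
  assumes AB: "A \<in> V" "B \<in> V" and P: "P \<in> ec_curve A B" "P = Affine x y" "y \<noteq> 0"
    and near: "small (zcoord P)" "small (wcoord P)"
  defines "Q \<equiv> \<lambda>k. (ec_add A P ^^ k) Infinity"
  shows "Q k \<in> ec_curve A B" "\<forall>x y. Q k = Affine x y \<longrightarrow> y \<noteq> 0"
    "small (zcoord (Q k))" "small (wcoord (Q k))"
    "zcoord (Q (Suc k)) = z_sum A B (zcoord P) (wcoord P) (zcoord (Q k)) (wcoord (Q k))"
    "wcoord (Q (Suc k)) = w_sum A B (zcoord P) (wcoord P) (zcoord (Q k)) (wcoord (Q k))"
proof -
  let ?s = "\<lambda>k. chord_slope A B (zcoord P) (wcoord P) (zcoord (Q k)) (wcoord (Q k))"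
  have Q_Suc: "Q (Suc k) = ec_add A P (Q k)" for k by (simp add: Q_def)
  have step: "unit (chord_den A B (zcoord P) (wcoord P) (zcoord (Q k)) (wcoord (Q k)))"
    "small (?s k)" "unit (cubic_lead A B (?s k))"
    if "small (zcoord (Q k))" "small (wcoord (Q k))" for k
    using that AB near by (auto intro!: unit_chord_den small_chord_slope unit_cubic_lead)
  have inv: "Q k \<in> ec_curve A B \<and> (\<forall>x y. Q k = Affine x y \<longrightarrow> y \<noteq> 0) \<and>
      small (zcoord (Q k)) \<and> small (wcoord (Q k))" for k
  proof (induction k)
    case 0
    show ?case by (simp add: Q_def ec_curve_def ec_points_def)
  next
    case (Suc k)
    then have nz: "chord_den A B (zcoord P) (wcoord P) (zcoord (Q k)) (wcoord (Q k)) \<noteq> 0"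
        "cubic_lead A B (?s k) \<noteq> 0"
      using step unit_nonzero by blast+
    have Qk: "Q k \<in> ec_curve A B" "\<forall>x y. Q k = Affine x y \<longrightarrow> y \<noteq> 0"
      using Suc by auto
    have add: "Q (Suc k) \<in> ec_curve A B" "\<forall>x y. Q (Suc k) = Affine x y \<longrightarrow> y \<noteq> 0"
      "zcoord (Q (Suc k)) = z_sum A B (zcoord P) (wcoord P) (zcoord (Q k)) (wcoord (Q k))"
      "wcoord (Q (Suc k)) = w_sum A B (zcoord P) (wcoord P) (zcoord (Q k)) (wcoord (Q k))"
      unfolding Q_Suc
      by (rule ec_add_zw[OF P(1) Qk(1) P(2,3) Qk(2) nz])+
    have i: "small (chord_icpt A B (zcoord P) (wcoord P) (zcoord (Q k)) (wcoord (Q k)))"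
      unfolding chord_icpt_def using near Suc step[of k] by (intro small_diff small_mult) (auto intro: small_mem)
    have z: "small (zcoord (Q (Suc k)))"
      unfolding add(3) z_sum_def Let_def using near Suc step[of k] AB i
      by (intro small_add small_mult[where y = "inverse _"] small_mult'[OF i])
        (auto simp: unit_def intro!: add_mem mult_mem power_mem intro: small_mem)
    have "small (wcoord (Q (Suc k)))"
      unfolding add(4) w_sum_def using z i Suc step[of k] unfolding add(3) by (intro small_diff small_mult) (auto intro: small_mem)
    then show ?case using z add(1,2) by auto
  qed
  show "Q k \<in> ec_curve A B" "\<forall>x y. Q k = Affine x y \<longrightarrow> y \<noteq> 0"
    "small (zcoord (Q k))" "small (wcoord (Q k))"
    using inv by blast+
  show "zcoord (Q (Suc k)) = z_sum A B (zcoord P) (wcoord P) (zcoord (Q k)) (wcoord (Q k))"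
    "wcoord (Q (Suc k)) = w_sum A B (zcoord P) (wcoord P) (zcoord (Q k)) (wcoord (Q k))"
    unfolding Q_Suc using inv[of k] step[of k] unit_nonzero
    by (auto intro!: ec_add_zw(3,4)[OF P(1) _ P(2,3)])
qed

lemma zcoord_multiple_near_infinity:
  assumes AB: "A \<in> V" "B \<in> V" and P: "P \<in> ec_curve A B" "P = Affine x y" "y \<noteq> 0"
    and near: "small (zcoord P)" "small (wcoord P)"
    and log: "\<And>i. i > 0 \<Longrightarrow> small (zcoord P ^ i / of_nat (Suc i))"
    and "k > 0"
  shows "unit (zcoord ((ec_add A P ^^ k) Infinity) / (of_nat k * zcoord P))"
proof -
  define z w where "z = zcoord P" and "w = wcoord P"
  define zs ws where "zs = (\<lambda>k. zcoord ((ec_add A P ^^ k) Infinity))"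
    and "ws = (\<lambda>k. wcoord ((ec_add A P ^^ k) Infinity))"
  define s where "s = (\<lambda>k. chord_slope A B z w (zs k) (ws k))"
  define i where "i = (\<lambda>k. chord_icpt A B z w (zs k) (ws k))"
  have folds: "zcoord ((ec_add A P ^^ k) Infinity) = zs k" "wcoord ((ec_add A P ^^ k) Infinity) = ws k" for k
    by (simp_all add: zs_def ws_def)
  note Q = multiples_near_infinity[OF AB P near, unfolded folds, folded z_def w_def]
  have zsws: "small (zs k)" "small (ws k)" for k
    using Q(3,4) by blast+
  have zw: "w = z ^ 3 + A * z * w ^ 2 + B * w ^ 3"
    unfolding z_def w_def using P by (intro zw_equation) auto
  have near': "small z" "small w" using near by (simp_all add: z_def w_def)
  have "w \<noteq> 0" using P by (simp add: w_def)
  define u where "u = 1 - (A * z * w + B * w\<^sup>2)"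
  have u: "unit u"
    unfolding u_def using AB near'
    by (intro unit_diff_small unit_one small_add small_mult' small_power) (auto intro: mult_mem small_mem)
  have "w * u = z ^ 3"
    unfolding u_def using zw by (simp add: algebra_simps power2_eq_square power3_eq_cube)
  then have "z \<noteq> 0" using \<open>w \<noteq> 0\<close> u unit_nonzero by auto
  \<comment> \<open>The curve equation reads w u = z^3 with a unit u, so w is divisible by z. Hence
    the intercepts, and with them the increments of z(kP) and w(kP), carry a factor z.\<close>
  define v where "v = z\<^sup>2 * inverse u"
  have v: "v \<in> V" "w = z * v"
  proof -
    show "v \<in> V"
      unfolding v_def using u near'(1)[THEN small_mem] by (intro mult_mem power_mem) (simp_all add: unit_def)
    have "w = z ^ 3 / u"
      using \<open>w * u = z ^ 3\<close> unit_nonzero[OF u] by (simp add: eq_divide_eq)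
    then show "w = z * v"
      by (simp add: v_def divide_inverse power2_eq_square power3_eq_cube)
  qed
  have den: "unit (chord_den A B z w (zs k) (ws k))" for k
    using AB near' zsws by (intro unit_chord_den)
  have s_small: "small (s k)" for k
    unfolding s_def using AB near' zsws by (intro small_chord_slope)
  have lead: "unit (cubic_lead A B (s k))" for k
    using AB s_small by (intro unit_cubic_lead)
  have fold_si: "chord_slope A B z w (zs k) (ws k) = s k" "chord_icpt A B z w (zs k) (ws k) = i k" for k
    by (simp_all add: s_def i_def)
  have i: "i k = z * (v - s k)" for k
    by (simp add: i_def chord_icpt_def s_def v(2) algebra_simps)
  define g where "g = (\<lambda>k. 1 + (2 * A * s k + 3 * B * (s k * s k)) * (v - s k) * inverse (cubic_lead A B (s k)))"
  have zs_Suc: "zs (Suc k) = zs k + z * g k" for k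
    using Q(5)[of k]
    by (simp add: z_sum_def Let_def fold_si i g_def algebra_simps power2_eq_square)
  have ws_eq: "ws k = s k * zs k + i k" for k
    unfolding s_def i_def
  proof (rule zw_chord[OF zw])
    show "ws k = zs k ^ 3 + A * zs k * (ws k)\<^sup>2 + B * ws k ^ 3"
      unfolding zs_def ws_def using Q(1,2) by (rule zw_equation)
  qed (use den unit_nonzero in auto)
  \<comment> \<open>kP lies on the line w = s z + i, and (k+1)P on its mirror image w = s z - i
    under negation.\<close>
  have ws_Suc: "ws (Suc k) = ws k + z * (s k * g k - 2 * (v - s k))" for k
  proof -
    have "ws (Suc k) = s k * zs (Suc k) - i k"
      using Q(6)[of k] Q(5)[of k]
      by (simp add: w_sum_def fold_si)
    then show ?thesis
      unfolding zs_Suc ws_eq[of k] i by (simp add: algebra_simps)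
  qed
  have zV: "z \<in> V" "w \<in> V" using near' small_mem by auto
  \<comment> \<open>Bootstrapping: the increments divided by z are built from \<open>zs\<close> and
    \<open>ws\<close> by ring operations and inverses of units, so N good differences of both
    sequences yield N good differences of the increments, hence N + 1 of the sequences.\<close>
  have "divdiff z N zs \<and> divdiff z N ws" for N
  proof (induction N)
    case 0
    then show ?case using zsws small_mem by auto
  next
    case (Suc N)
    note dd = divdiff_add divdiff_mult[OF zV(1)] divdiff_const
    have d: "divdiff z N zs" "divdiff z N ws" using Suc by auto
    \<comment> \<open>Subtractions are written as sums with factors -1 to fit the closure rules
      \<open>dd\<close>.\<close>
    have "divdiff z N (\<lambda>k. 1 + (- 1) * (A * z * (w + ws k)) + (- 1) * (B * (w * w + w * ws k + ws k * ws k)))"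
      using d AB zV by (intro dd) (auto intro: uminus_mem)
    then have "divdiff z N (\<lambda>k. chord_den A B z w (zs k) (ws k))"
      by (simp add: chord_den_def power2_eq_square)
    then have "divdiff z N (\<lambda>k. inverse (chord_den A B z w (zs k) (ws k)))"
      using den zV by (intro divdiff_inverse)
    moreover have "divdiff z N (\<lambda>k. z * z + z * zs k + zs k * zs k + A * (ws k * ws k))"
      using d AB zV by (intro dd)
    ultimately have s: "divdiff z N s"
      unfolding s_def chord_slope_def chord_num_def power2_eq_square using d AB zV by (intro dd)
    have "divdiff z N (\<lambda>k. 1 + A * (s k * s k) + B * (s k * s k * s k))"
      using s AB by (intro dd) auto
    then have "divdiff z N (\<lambda>k. cubic_lead A B (s k))"
      by (simp add: cubic_lead_def power2_eq_square power3_eq_cube)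
    then have "divdiff z N (\<lambda>k. inverse (cubic_lead A B (s k)))"
      using lead zV by (intro divdiff_inverse)
    then have "divdiff z N (\<lambda>k. 1 + (2 * A * s k + 3 * B * (s k * s k)) * (v + (- 1) * s k) * inverse (cubic_lead A B (s k)))"
      using s AB v by (intro dd) (auto intro: mult_mem uminus_mem)
    then have g: "divdiff z N g" by (simp add: g_def)
    have "divdiff z N (\<lambda>k. s k * g k + (- 2) * (v + (- 1) * s k))"
      using s g v by (intro dd) (auto intro: uminus_mem)
    then have h: "divdiff z N (\<lambda>k. s k * g k - 2 * (v - s k))" by (simp add: algebra_simps)
    show ?case
      using g h zs_Suc ws_Suc zsws small_mem by auto
  qed
  moreover have "zs 0 = 0" by (simp add: zs_def)
  moreover have "zs 1 = z"
    by (simp add: zs_def z_def P(2))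
  ultimately show ?thesis
    using divdiff_linear_term_dominates[of z zs k] log \<open>k > 0\<close> \<open>z \<noteq> 0\<close> by (simp add: zs_def z_def)
qed

lemma zcoord_neg: "zcoord (ec_neg P) = - zcoord P"
  by (cases P) auto

lemma zcoord_ec_mult_near_infinity:
  assumes "A \<in> V" "B \<in> V" and "P \<in> ec_curve A B" "P = Affine x y" "y \<noteq> 0"
    and "small (zcoord P)" "small (wcoord P)"
    and "\<And>i. i > 0 \<Longrightarrow> small (zcoord P ^ i / of_nat (Suc i))"
    and "m \<noteq> 0"
  shows "unit (zcoord (ec_mult A m P) / (of_int m * zcoord P))"
proof (cases "m > 0")
  case True
  have "of_int m = (of_nat (nat m) :: 'a)" using True by simp
  then show ?thesis
    using zcoord_multiple_near_infinity[OF assms(1-8), of "nat m"] True by (simp add: ec_mult_def)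
next
  case False
  have "of_int m = - (of_nat (nat (- m)) :: 'a)" using False by simp
  then show ?thesis
    using zcoord_multiple_near_infinity[OF assms(1-8), of "nat (- m)"] False assms(9)
    by (simp add: ec_mult_def zcoord_neg)
qed

end

section \<open>Existence of p-adic valuation rings\<close>

definition subring_set :: "'a::comm_ring_1 set \<Rightarrow> bool" where
  "subring_set R \<longleftrightarrow> 1 \<in> R \<and> (\<forall>x\<in>R. \<forall>y\<in>R. x - y \<in> R \<and> x * y \<in> R)"

lemma subring_setD:
  assumes "subring_set R"
  shows "1 \<in> R" "0 \<in> R" "x \<in> R \<Longrightarrow> y \<in> R \<Longrightarrow> x - y \<in> R" "x \<in> R \<Longrightarrow> y \<in> R \<Longrightarrow> x * y \<in> R"
    "x \<in> R \<Longrightarrow> - x \<in> R" "x \<in> R \<Longrightarrow> y \<in> R \<Longrightarrow> x + y \<in> R" "x \<in> R \<Longrightarrow> x ^ k \<in> R" "of_nat k \<in> R"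
    "(\<And>i. i \<in> I \<Longrightarrow> f i \<in> R) \<Longrightarrow> sum f I \<in> R"
proof -
  have one: "1 \<in> R" and diff: "x - y \<in> R" and mult: "x * y \<in> R" if "x \<in> R" "y \<in> R" for x y
    using assms that by (auto simp: subring_set_def)
  have one: "1 \<in> R" using assms by (auto simp: subring_set_def)
  have zero: "0 \<in> R" using diff[OF one one] by simp
  have uminus: "- x \<in> R" if "x \<in> R" for x using diff[OF zero that] by simp
  have add: "x + y \<in> R" if "x \<in> R" "y \<in> R" for x y using diff[OF that(1) uminus[OF that(2)]] by simp
  show "1 \<in> R" "0 \<in> R" "x \<in> R \<Longrightarrow> y \<in> R \<Longrightarrow> x - y \<in> R" "x \<in> R \<Longrightarrow> y \<in> R \<Longrightarrow> x * y \<in> R"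
    "x \<in> R \<Longrightarrow> - x \<in> R" "x \<in> R \<Longrightarrow> y \<in> R \<Longrightarrow> x + y \<in> R"
    using one zero diff mult uminus add by auto
  show "x \<in> R \<Longrightarrow> x ^ k \<in> R" by (induction k) (auto intro: one mult)
  show "of_nat k \<in> R" by (induction k) (auto intro: zero one add)
  show "(\<And>i. i \<in> I \<Longrightarrow> f i \<in> R) \<Longrightarrow> sum f I \<in> R"
    by (induction I rule: infinite_finite_induct) (auto intro: zero add)
qed

definition adjoin :: "'a::comm_ring_1 set \<Rightarrow> 'a \<Rightarrow> 'a set" where
  "adjoin R x = {poly q x | q. \<forall>i. coeff q i \<in> R}"

lemma subring_set_adjoin:
  assumes R: "subring_set R"
  shows "subring_set (adjoin R x)"
proof -
  note R = subring_setD[OF R]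
  have "1 \<in> adjoin R x"
    unfolding adjoin_def using R(1,2) by (auto intro!: exI[of _ 1] simp: coeff_1)
  moreover have "a - b \<in> adjoin R x" "a * b \<in> adjoin R x" if ab: "a \<in> adjoin R x" "b \<in> adjoin R x" for a b
  proof -
    obtain p q where "\<forall>i. coeff p i \<in> R" "\<forall>i. coeff q i \<in> R" "a = poly p x" "b = poly q x"
      using ab by (auto simp: adjoin_def)
    then have "\<forall>i. coeff (p - q) i \<in> R" "\<forall>i. coeff (p * q) i \<in> R"
      "a - b = poly (p - q) x" "a * b = poly (p * q) x"
      using R(3,4) by (auto intro!: R(9) simp: coeff_mult)
    then show "a - b \<in> adjoin R x" "a * b \<in> adjoin R x"
      unfolding adjoin_def by blast+
  qed
  ultimately show ?thesis by (simp add: subring_set_def)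
qed

lemma subset_adjoin:
  assumes R: "subring_set R" shows "R \<subseteq> adjoin R x"
  using subring_setD[OF R] unfolding adjoin_def
  by (auto intro!: exI[of _ "[:_:]"] simp: coeff_pCons split: nat.split)

lemma mem_adjoin:
  assumes R: "subring_set R" shows "x \<in> adjoin R x"
  using subring_setD[OF R] unfolding adjoin_def
  by (auto intro!: exI[of _ "[:0, 1:]"] simp: coeff_pCons split: nat.split)

lemma ex_maximal_subring:
  fixes a :: "'a::comm_ring_1"
  assumes R: "subring_set R" "a \<notin> R"
  obtains V where "subring_set V" "a \<notin> V" "R \<subseteq> V"
    "\<And>W. subring_set W \<Longrightarrow> V \<subseteq> W \<Longrightarrow> a \<notin> W \<Longrightarrow> W = V"
proof -
  let ?A = "{V. subring_set V \<and> a \<notin> V \<and> R \<subseteq> V}"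
  have "\<exists>M\<in>?A. \<forall>Z\<in>?A. M \<subseteq> Z \<longrightarrow> Z = M"
  proof (rule subset_Zorn_nonempty)
    show "?A \<noteq> {}" using R by auto
    fix C assume C: "C \<noteq> {}" "subset.chain ?A C"
    then have sub: "C \<subseteq> ?A" and lin: "\<And>Y Z. Y \<in> C \<Longrightarrow> Z \<in> C \<Longrightarrow> Y \<subseteq> Z \<or> Z \<subseteq> Y"
      unfolding subset.chain_def by auto
    have "x - y \<in> \<Union>C \<and> x * y \<in> \<Union>C" if "x \<in> \<Union>C" "y \<in> \<Union>C" for x y
    proof -
      obtain Z where "Z \<in> C" "x \<in> Z" "y \<in> Z" using \<open>x \<in> \<Union>C\<close> \<open>y \<in> \<Union>C\<close> lin by blast
      moreover have "subring_set Z" using \<open>Z \<in> C\<close> sub by auto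
      ultimately show ?thesis using subring_setD(3,4) by blast
    qed
    then have "subring_set (\<Union>C)" using C(1) sub by (auto simp: subring_set_def)
    then show "\<Union>C \<in> ?A" using C(1) sub by auto
  qed
  then obtain V where V: "V \<in> ?A" "\<forall>Z\<in>?A. V \<subseteq> Z \<longrightarrow> Z = V" by auto
  then show ?thesis using that[of V] by auto
qed

text \<open>Chevalley's argument: if neither \<open>x\<close> nor \<open>1/x\<close> lay in \<open>V\<close>, then \<open>1/p\<close> would be a polynomial in
  each of them, and of two such relations of minimal degrees the longer one could be shortened.\<close>

lemma maximal_subring_is_valuation_ring:
  fixes p :: "'a::field_char_0"
  assumes V: "subring_set V" "p \<in> V" "inverse p \<notin> V"
    and max: "\<And>W. subring_set W \<Longrightarrow> V \<subseteq> W \<Longrightarrow> inverse p \<notin> W \<Longrightarrow> W = V"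
  shows "valuation_ring V"
proof -
  note R = subring_setD[OF V(1)]
  have "p \<noteq> 0" using V(2,3) by auto
  \<comment> \<open>p lies in the Jacobson radical of V. If u = 1 - p b were not invertible,
    maximality would put 1/p into V[1/u]; clearing denominators makes a power of u divisible by p,
    although every power of u is 1 modulo p.\<close>
  have inv1: "inverse (1 - p * b) \<in> V" if "b \<in> V" for b
  proof (rule ccontr)
    assume n: "inverse (1 - p * b) \<notin> V"
    define u where "u = 1 - p * b"
    have u: "u \<in> V" "u \<noteq> 0" using that n V(2) R by (auto simp: u_def)
    have "inverse p \<in> adjoin V (inverse u)"
      using max[OF subring_set_adjoin[OF V(1)] subset_adjoin[OF V(1)]] mem_adjoin[OF V(1)] n
      unfolding u_def by metis
    then obtain q where q: "\<forall>i. coeff q i \<in> V" "inverse p = poly q (inverse u)"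
      by (auto simp: adjoin_def)
    define v where "v = (\<Sum>i\<le>degree q. coeff q i * u ^ (degree q - i))"
    have "v \<in> V" unfolding v_def using q u by (intro R(4,7,9)) auto
    have "inverse p * u ^ degree q = v"
      unfolding v_def q(2) poly_altdef sum_distrib_right using u(2)
      by (intro sum.cong) (auto simp: power_diff field_simps)
    then have "u ^ degree q = p * v" using \<open>p \<noteq> 0\<close> by (simp add: field_simps)
    moreover have "\<exists>c\<in>V. u ^ k = 1 - p * c" for k
    proof (induction k)
      case (Suc k)
      then obtain c where c: "c \<in> V" "u ^ k = 1 - p * c" by auto
      have "u ^ Suc k = 1 - p * (b + c - p * b * c)"
        by (simp only: power_Suc c(2)) (simp add: u_def algebra_simps)
      moreover have "b + c - p * b * c \<in> V" using c(1) that V(2) R by auto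
      ultimately show ?case by auto
    qed (use R in \<open>auto intro: bexI[of _ 0]\<close>)
    ultimately obtain c where "c \<in> V" "1 - p * c = p * v" by metis
    then have "inverse p = v + c" using \<open>p \<noteq> 0\<close> by (simp add: field_simps)
    then show False using V(3) \<open>c \<in> V\<close> \<open>v \<in> V\<close> R by auto
  qed
  have False if x: "x \<notin> V" "inverse x \<notin> V" for x
  proof -
    have "x \<noteq> 0" using x R by auto
    define rel where "rel y n a \<longleftrightarrow> (\<forall>i. a i \<in> V) \<and> 1 = p * (\<Sum>i\<le>n. a i * y ^ i)" for y n and a :: "nat \<Rightarrow> 'a"
    have ex: "\<exists>n a. rel y n a" if "y \<notin> V" for y
    proof -
      have "inverse p \<in> adjoin V y"
        using max[OF subring_set_adjoin[OF V(1)] subset_adjoin[OF V(1)]] mem_adjoin[OF V(1)] that by metis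
      then obtain q where "\<forall>i. coeff q i \<in> V" "inverse p = poly q y" by (auto simp: adjoin_def)
      moreover have "p * inverse p = 1" using \<open>p \<noteq> 0\<close> by simp
      ultimately have "rel y (degree q) (coeff q)" by (simp add: rel_def poly_altdef)
      then show ?thesis by blast
    qed
    define N where "N y = (LEAST n. \<exists>a. rel y n a)" for y
    have N: "\<exists>a. rel y (N y) a" if "y \<notin> V" for y
      unfolding N_def using ex[OF that] by (rule LeastI_ex)
    have N_le: "N y \<le> n" if "rel y n a" for y n a
      unfolding N_def using that by (blast intro: Least_le)
    have shorten: False if y: "y \<notin> V" "inverse y \<notin> V" "N (inverse y) \<le> N y" for y
    proof -
      obtain a where a: "rel y (N y) a" using N y by blast
      obtain b where b: "rel (inverse y) (N (inverse y)) b" using N y by blast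
      define n m where "n = N y" and "m = N (inverse y)"
      have "y \<noteq> 0" using y R by auto
      define u where "u = inverse (1 - p * b 0)"
      have u: "u \<in> V" using b inv1 by (auto simp: u_def rel_def)
      have "1 - p * b 0 \<noteq> 0"
      proof
        assume "1 - p * b 0 = 0"
        then have "inverse p = b 0" using \<open>p \<noteq> 0\<close> by (simp add: field_simps)
        then show False using b V(3) by (auto simp: rel_def)
      qed
      have "1 = p * (\<Sum>i\<le>m. b i * inverse y ^ i)" using b by (simp add: rel_def m_def)
      also have "(\<Sum>i\<le>m. b i * inverse y ^ i) = b 0 + (\<Sum>i\<in>{..m} - {0}. b i * inverse y ^ i)"
        by (subst sum.remove[of _ 0]) auto
      finally have "1 - p * b 0 = p * (\<Sum>i\<in>{..m} - {0}. b i * inverse y ^ i)"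
        by (simp add: algebra_simps)
      \<comment> \<open>Solved for 1, the relation in 1/y has no constant term. Multiplied by the
        leading term a n y^n of the other relation, it replaces that term by terms of degree below
        n.\<close>
      then have one: "1 = u * p * (\<Sum>i\<in>{..m} - {0}. b i * inverse y ^ i)"
        using \<open>1 - p * b 0 \<noteq> 0\<close> by (simp add: u_def field_simps)
      define c where "c = a n * u * p"
      have c: "c \<in> V" using a u V(2) R by (auto simp: c_def rel_def)
      have "m \<le> n" using y by (simp add: n_def m_def)
      have "n > 0"
      proof (rule ccontr)
        assume "\<not> n > 0"
        then have "1 = p * a 0" using a by (simp add: rel_def n_def)
        then have "inverse p = a 0" using \<open>p \<noteq> 0\<close> by (simp add: field_simps)
        then show False using a V(3) by (auto simp: rel_def)
      qed
      have "a n * y ^ n = a n * y ^ n * (u * p * (\<Sum>i\<in>{..m} - {0}. b i * inverse y ^ i))"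
        using one by simp
      also have "\<dots> = (\<Sum>i\<in>{..m} - {0}. c * b i * (y ^ n * inverse y ^ i))"
        by (simp add: c_def sum_distrib_left algebra_simps)
      also have "\<dots> = (\<Sum>i\<in>{..m} - {0}. c * b i * y ^ (n - i))"
        using \<open>y \<noteq> 0\<close> \<open>m \<le> n\<close> by (intro sum.cong) (auto simp: power_diff field_simps)
      also have "\<dots> = (\<Sum>j\<in>{n-m..n-1}. c * b (n - j) * y ^ j)"
        using \<open>n > 0\<close> \<open>m \<le> n\<close>
        by (intro sum.reindex_bij_witness[of _ "\<lambda>j. n - j" "\<lambda>i. n - i"]) auto
      also have "\<dots> = (\<Sum>j\<le>n-1. (if n - m \<le> j then c * b (n - j) else 0) * y ^ j)"
        by (rule sum.mono_neutral_cong_left) auto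
      finally have top: "a n * y ^ n = (\<Sum>j\<le>n-1. (if n - m \<le> j then c * b (n - j) else 0) * y ^ j)" .
      have "(\<Sum>i\<le>n. a i * y ^ i) = a n * y ^ n + (\<Sum>i\<le>n-1. a i * y ^ i)"
        using \<open>n > 0\<close> by (cases n) auto
      also have "\<dots> = (\<Sum>j\<le>n-1. (a j + (if n - m \<le> j then c * b (n - j) else 0)) * y ^ j)"
        unfolding top by (simp add: algebra_simps sum.distrib)
      finally have "rel y (n - 1) (\<lambda>j. a j + (if n - m \<le> j then c * b (n - j) else 0))"
        using a b c R by (auto simp: rel_def n_def [symmetric])
      from N_le[OF this] \<open>n > 0\<close> show False by (simp add: n_def)
    qed
    show False
      using shorten[of x] shorten[of "inverse x"] x by (cases "N (inverse x) \<le> N x") auto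
  qed
  then show ?thesis using R by unfold_locales auto
qed

text \<open>Zorn's lemma starts from the integers, with 1/p as the element to avoid.\<close>

lemma ex_valuation_ring:
  assumes "p > 1"
  obtains V :: "'a::field_char_0 set" where "valuation_ring V" "inverse (of_nat p) \<notin> V"
proof -
  have R: "subring_set (\<int> :: 'a set)" by (auto simp: subring_set_def)
  have "inverse (of_nat p) \<notin> (\<int> :: 'a set)"
  proof
    assume "inverse (of_nat p) \<in> (\<int> :: 'a set)"
    then obtain k where k: "inverse (of_nat p) = (of_int k :: 'a)" by (auto elim: Ints_cases)
    have "(of_int (int p * k) :: 'a) = of_nat p * inverse (of_nat p)"
      unfolding k by simp
    also have "\<dots> = of_int 1" using assms by simp
    finally have "int p * k = 1" unfolding of_int_eq_iff .
    then show False using assms by (simp add: zmult_eq_1_iff)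
  qed
  from ex_maximal_subring[OF R this] obtain V :: "'a set" where V: "subring_set V" "inverse (of_nat p) \<notin> V"
    "\<And>W. subring_set W \<Longrightarrow> V \<subseteq> W \<Longrightarrow> inverse (of_nat p) \<notin> W \<Longrightarrow> W = V" by metis
  then show ?thesis
    using that maximal_subring_is_valuation_ring[OF V(1) subring_setD(8)[OF V(1)] V(2)] by blast
qed

locale padic_valuation_ring = valuation_ring V for V :: "'a::field_char_0 set" +
  fixes p :: nat
  assumes prime: "Factorial_Ring.prime p" and inverse_p_notin: "inverse (of_nat p) \<notin> V"
begin

lemma small_p: "small (of_nat p)"
  using inverse_p_notin by (simp add: small_def unit_def)

text \<open>If p does not divide k, Bezout gives a k = 1 - b p, a unit because p is small; a factor
  in V of a unit is a unit.\<close>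

lemma unit_of_int_iff: "unit (of_int k) \<longleftrightarrow> \<not> int p dvd k"
proof
  assume u: "unit (of_int k)"
  show "\<not> int p dvd k"
  proof
    assume "int p dvd k"
    then obtain j where "k = int p * j" by auto
    then have "small (of_int k)" using small_mult[OF small_p, of "of_int j"] by simp
    then show False using u not_unit_small by blast
  qed
next
  assume "\<not> int p dvd k"
  then have "coprime k (int p)"
    using prime_imp_coprime[of "int p" k] prime by (simp add: coprime_commute)
  then obtain a b where ab: "a * k + b * int p = 1" using coprime_iff_gcd_eq_1 bezout_int by metis
  have "a * k = 1 - b * int p" using ab by simp
  then have "of_int (a * k) = (of_int (1 - b * int p) :: 'a)" by (rule arg_cong)
  then have "of_int a * of_int k = (1 - of_int b * of_nat p :: 'a)" by simp
  moreover have "unit (1 - of_int b * of_nat p)"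
    using small_p by (intro unit_diff_small small_mult' unit_one) auto
  ultimately have "unit (of_int k * of_int a)" by (simp add: mult.commute)
  then show "unit (of_int k)"
    using small_mult[of "of_int k" "of_int a"] not_unit_small not_small_imp_unit of_int_mem by blast
qed

lemma unit_of_nat_iff: "unit (of_nat k) \<longleftrightarrow> \<not> p dvd k"
  using unit_of_int_iff[of "int k"] by simp

end

section \<open>Number fields\<close>

definition subfield_set :: "'a::field set \<Rightarrow> bool" where
  "subfield_set K \<longleftrightarrow> subring_set K \<and> (\<forall>x\<in>K. inverse x \<in> K)"

lemma subfield_setD:
  assumes "subfield_set K"
  shows "1 \<in> K" "0 \<in> K" "x \<in> K \<Longrightarrow> y \<in> K \<Longrightarrow> x - y \<in> K" "x \<in> K \<Longrightarrow> y \<in> K \<Longrightarrow> x * y \<in> K"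
    "x \<in> K \<Longrightarrow> - x \<in> K" "x \<in> K \<Longrightarrow> y \<in> K \<Longrightarrow> x + y \<in> K" "x \<in> K \<Longrightarrow> x ^ k \<in> K" "of_nat k \<in> K"
    "(\<And>i. i \<in> I \<Longrightarrow> f i \<in> K) \<Longrightarrow> sum f I \<in> K" "x \<in> K \<Longrightarrow> inverse x \<in> K"
    "x \<in> K \<Longrightarrow> y \<in> K \<Longrightarrow> x / y \<in> K" "x \<in> K \<Longrightarrow> x powi j \<in> K" "numeral l \<in> K"
proof -
  have r: "subring_set K" and inv: "\<And>x. x \<in> K \<Longrightarrow> inverse x \<in> K"
    using assms by (auto simp: subfield_set_def)
  note K = subring_setD[OF r]
  show "1 \<in> K" "0 \<in> K" "x \<in> K \<Longrightarrow> y \<in> K \<Longrightarrow> x - y \<in> K" "x \<in> K \<Longrightarrow> y \<in> K \<Longrightarrow> x * y \<in> K"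
    "x \<in> K \<Longrightarrow> - x \<in> K" "x \<in> K \<Longrightarrow> y \<in> K \<Longrightarrow> x + y \<in> K" "x \<in> K \<Longrightarrow> x ^ k \<in> K" "of_nat k \<in> K"
    "(\<And>i. i \<in> I \<Longrightarrow> f i \<in> K) \<Longrightarrow> sum f I \<in> K" "x \<in> K \<Longrightarrow> inverse x \<in> K"
    by (use K inv in simp_all) (rule K(9))
  show "x \<in> K \<Longrightarrow> y \<in> K \<Longrightarrow> x / y \<in> K" "x \<in> K \<Longrightarrow> x powi j \<in> K"
    using K inv by (auto simp: divide_inverse power_int_def)
  show "numeral l \<in> K" using K(8)[of "numeral l"] by simp
qed

section \<open>Translation between the ring \<open>CC\<close> and the field type\<close>

lemma CC_simps [simp]:
  "carrier CC = UNIV" "x \<otimes>\<^bsub>CC\<^esub> y = x * y" "x \<oplus>\<^bsub>CC\<^esub> y = x + y" "\<one>\<^bsub>CC\<^esub> = 1" "\<zero>\<^bsub>CC\<^esub> = 0"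
  by (simp_all add: ring_of_type_algebra_def)

interpretation CC: ring CC
  by (rule ring_from_type_algebra)

lemma CC_a_inv: "\<ominus>\<^bsub>CC\<^esub> x = - x"
proof -
  have "x \<oplus>\<^bsub>CC\<^esub> (- x) = \<zero>\<^bsub>CC\<^esub>" by simp
  then show ?thesis using CC.minus_equality[of "- x" x] by (simp add: add.commute)
qed

lemma CC_m_inv: "x \<noteq> 0 \<Longrightarrow> inv\<^bsub>CC\<^esub> x = inverse x"
  by (rule comm_monoid.comm_inv_char[OF cring.axioms(2)[OF cring_from_type_algebra]]) auto

lemma subfield_CC_iff: "subfield K CC \<longleftrightarrow> subfield_set K"
proof
  assume K: "subfield K CC"
  note S = subringE[OF subfieldE(1)[OF K]]
  have "x - y \<in> K" if "x \<in> K" "y \<in> K" for x y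
    using S(5)[OF that(2)] S(7)[OF that(1), of "- y"] by (simp add: CC_a_inv)
  moreover have "inverse x \<in> K" if "x \<in> K" for x
    using CC.subfield_m_inv(1)[OF K, of x] that S(2) by (cases "x = 0") (auto simp: CC_m_inv)
  ultimately show "subfield_set K"
    using S(3,6) by (auto simp: subfield_set_def subring_set_def)
next
  assume K: "subfield_set K"
  note K = subfield_setD[OF K]
  show "subfield K CC"
  proof (rule field.subfieldI'[OF field_from_type_algebra])
    show "subring K CC"
      by (rule CC.subringI) (use K in \<open>auto simp: CC_a_inv\<close>)
  qed (use K in \<open>auto simp: CC_m_inv\<close>)
qed

lemma subfield_set_Rats: "subfield_set (\<rat> :: complex set)"
  by (auto simp: subfield_set_def subring_set_def)

section \<open>Linear dependence over a subfield\<close>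

lemma line_extension_CC: "CC.line_extension K v E = {k * v + e | k e. k \<in> K \<and> e \<in> E}"
  by (auto simp: CC.line_extension_def r_coset_def set_add_def set_mult_def)

lemma dimension_imp_subspace:
  assumes "CC.dimension n K E" "subfield_set K"
  shows "0 \<in> E \<and> (\<forall>x\<in>E. \<forall>y\<in>E. \<forall>c\<in>K. x + c * y \<in> E)"
  using assms
proof (induction rule: CC.dimension.induct)
  case (Suc_dim v E n K)
  note K = subfield_setD[OF Suc_dim.prems]
  have "k * v + e + c * (k' * v + e') \<in> CC.line_extension K v E"
    if "k \<in> K" "k' \<in> K" "c \<in> K" "e \<in> E" "e' \<in> E" for k k' c e e'
  proof -
    have "k * v + e + c * (k' * v + e') = (k + c * k') * v + (e + c * e')"
      by (simp add: algebra_simps)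
    moreover have "k + c * k' \<in> K" "e + c * e' \<in> E"
      using that K(4,6) Suc_dim by auto
    ultimately show ?thesis unfolding line_extension_CC by blast
  qed
  moreover have "0 \<in> CC.line_extension K v E"
    using K(2) Suc_dim by (auto simp: line_extension_CC intro!: exI[of _ 0])
  ultimately show ?case by (auto simp: line_extension_CC)
qed auto

text \<open>Gaussian elimination along the inductive definition of dimension: a member with nonzero
  v-coordinate is the pivot, the others are reduced into E, and the coefficient of the pivot is
  corrected afterwards.\<close>

lemma dimension_imp_dependent:
  assumes "CC.dimension n K E" "subfield_set K"
    and "finite I" "card I > n" "\<And>i. i \<in> I \<Longrightarrow> f i \<in> E"
  shows "\<exists>c. (\<forall>i\<in>I. c i \<in> K) \<and> (\<exists>i\<in>I. c i \<noteq> 0) \<and> (\<Sum>i\<in>I. c i * f i) = 0"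
  using assms
proof (induction arbitrary: I f rule: CC.dimension.induct)
  case (zero_dim K)
  then have "I \<noteq> {}" by auto
  then show ?case using subfield_setD(1)[OF zero_dim(1)] zero_dim by (auto intro!: exI[of _ "\<lambda>_. 1"])
next
  case (Suc_dim v E n K)
  note K = subfield_setD[OF Suc_dim.prems(1)]
  note E = dimension_imp_subspace[OF Suc_dim.hyps(3) Suc_dim.prems(1)]
  have "\<forall>i\<in>I. \<exists>k e. k \<in> K \<and> e \<in> E \<and> f i = k * v + e"
    using Suc_dim.prems(4) by (auto simp: line_extension_CC)
  then obtain k e where ke: "\<And>i. i \<in> I \<Longrightarrow> k i \<in> K \<and> e i \<in> E \<and> f i = k i * v + e i"
    by metis
  show ?case
  proof (cases "\<forall>i\<in>I. k i = 0")
    case True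
    then show ?thesis using Suc_dim.IH[of I f] Suc_dim.prems ke by auto
  next
    case False
    then obtain j where j: "j \<in> I" "k j \<noteq> 0" by auto
    define g where "g i = f i - k i / k j * f j" for i
    have "g i \<in> E" if "i \<in> I" for i
    proof -
      have "g i = e i + (- (k i / k j)) * e j"
        using ke[OF that] ke[OF j(1)] j(2) by (simp add: g_def field_simps)
      moreover have "- (k i / k j) \<in> K"
        using ke[OF that] ke[OF j(1)] K(5,11) by simp
      ultimately show ?thesis using E ke[OF that] ke[OF j(1)] by metis
    qed
    then have "\<exists>c. (\<forall>i\<in>I - {j}. c i \<in> K) \<and> (\<exists>i\<in>I - {j}. c i \<noteq> 0) \<and> (\<Sum>i\<in>I - {j}. c i * g i) = 0"
      using Suc_dim.prems j by (intro Suc_dim.IH) auto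
    then obtain c where c: "\<forall>i\<in>I - {j}. c i \<in> K" "\<exists>i\<in>I - {j}. c i \<noteq> 0"
      "(\<Sum>i\<in>I - {j}. c i * g i) = 0" by blast
    define c' where "c' = c(j := - (\<Sum>i\<in>I - {j}. c i * (k i / k j)))"
    have "(\<Sum>i\<in>I. c' i * f i) = c' j * f j + (\<Sum>i\<in>I - {j}. c' i * f i)"
      using j Suc_dim.prems by (simp add: sum.remove)
    also have "(\<Sum>i\<in>I - {j}. c' i * f i) = (\<Sum>i\<in>I - {j}. c i * f i)"
      by (rule sum.cong) (auto simp: c'_def)
    also have "c' j * f j + \<dots> = (\<Sum>i\<in>I - {j}. c i * g i)"
      by (simp add: c'_def g_def sum_distrib_left sum_subtractf algebra_simps)
    finally have "(\<Sum>i\<in>I. c' i * f i) = 0" using c by simp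
    moreover have "\<forall>i\<in>I. c' i \<in> K"
    proof
      fix i assume "i \<in> I"
      show "c' i \<in> K"
        unfolding c'_def fun_upd_apply using c(1) ke j(1) \<open>i \<in> I\<close>
        by (auto intro!: K(5,9) K(4,11))
    qed
    moreover have "\<exists>i\<in>I. c' i \<noteq> 0" using c(2) by (auto simp: c'_def)
    ultimately show ?thesis by blast
  qed
qed

section \<open>Integer relations, and units above almost every prime\<close>

definition int_relation :: "nat \<Rightarrow> 'a::field_char_0 \<Rightarrow> bool" where
  "int_relation N x \<longleftrightarrow> (\<exists>c::nat \<Rightarrow> int. (\<exists>i\<le>N. c i \<noteq> 0) \<and> (\<Sum>i\<le>N. of_int (c i) * x ^ i) = 0)"

text \<open>N is the degree of K, as the powers of x up to N are too many to be independent. Its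
  uniformity over K is the point: it becomes the exponent \<open>fact N\<close> that clears all
  ramification above p.\<close>

lemma number_field_int_relation:
  assumes "number_field K"
  obtains N where "\<And>x. x \<in> K \<Longrightarrow> int_relation N x"
proof -
  have K: "subfield_set K" using assms by (simp add: number_field_def subfield_CC_iff)
  obtain N where N: "CC.dimension N \<rat> K"
    using assms by (auto simp: number_field_def CC.finite_dimension_def)
  have "int_relation N x" if "x \<in> K" for x
  proof -
    have "\<exists>c. (\<forall>i\<in>{..N}. c i \<in> \<rat>) \<and> (\<exists>i\<in>{..N}. c i \<noteq> 0) \<and> (\<Sum>i\<in>{..N}. c i * x ^ i) = 0"
      using subfield_setD(7)[OF K that] by (intro dimension_imp_dependent[OF N subfield_set_Rats]) auto
    then obtain c where c: "\<forall>i\<in>{..N}. c i \<in> \<rat>" "\<exists>i\<in>{..N}. c i \<noteq> 0" "(\<Sum>i\<in>{..N}. c i * x ^ i) = 0"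
      by auto
    have "\<exists>d. d > 0 \<and> of_nat d * c i \<in> \<int>" if "i \<in> {..N}" for i
    proof -
      have "c i \<in> \<rat>" using c that by auto
      then obtain a b :: int where ab: "b > 0" "c i = of_int a / of_int b" by (auto elim!: Rats_cases')
      then have "of_nat (nat b) * c i = of_int a" by simp
      then show ?thesis using ab(1) by (intro exI[of _ "nat b"]) auto
    qed
    then obtain d where d: "\<And>i. i \<in> {..N} \<Longrightarrow> d i > 0 \<and> of_nat (d i) * c i \<in> \<int>" by metis
    define D where "D = (\<Prod>i\<le>N. d i)"
    have "D > 0" using d by (auto simp: D_def)
    have "\<exists>e::int. of_int e = of_nat D * c i" if "i \<in> {..N}" for i
    proof -
      have "D = d i * (\<Prod>i\<in>{..N} - {i}. d i)" unfolding D_def using that by (simp add: prod.remove)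
      then have "of_nat D * c i = of_nat (\<Prod>i\<in>{..N} - {i}. d i) * (of_nat (d i) * c i)" by simp
      also have "\<dots> \<in> \<int>" by (rule Ints_mult[OF Ints_of_nat conjunct2[OF d[OF that]]])
      finally show ?thesis by (metis Ints_cases)
    qed
    then obtain e where e: "\<And>i. i \<in> {..N} \<Longrightarrow> of_int (e i) = of_nat D * c i" by metis
    have "(\<Sum>i\<le>N. of_int (e i) * x ^ i) = of_nat D * (\<Sum>i\<le>N. c i * x ^ i)"
      unfolding sum_distrib_left using e by (intro sum.cong) auto
    moreover obtain i where "i \<in> {..N}" "c i \<noteq> 0" using c by auto
    then have "e i \<noteq> 0" using e[of i] \<open>D > 0\<close> by auto
    ultimately show ?thesis using c(3) \<open>i \<in> {..N}\<close> by (auto simp: int_relation_def)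
  qed
  then show ?thesis by (rule that)
qed

text \<open>After division by its lowest power of x, the relation writes its lowest nonzero
  coefficient as a multiple of x with cofactor in V. If x is small, p must divide that coefficient,
  whose absolute value serves as M for all V and p.\<close>

lemma int_relation_not_small:
  fixes x :: "'a::field_char_0"
  assumes "int_relation N x" "x \<noteq> 0"
  shows "\<exists>M>0. \<forall>V p. padic_valuation_ring V p \<longrightarrow> \<not> p dvd M \<longrightarrow> \<not> valuation_ring.small V x"
proof -
  obtain c where c: "\<exists>i\<le>N. c i \<noteq> 0" "(\<Sum>i\<le>N. of_int (c i) * x ^ i) = 0"
    using assms by (auto simp: int_relation_def)
  define l where "l = (LEAST i. c i \<noteq> 0)"
  have l: "c l \<noteq> 0" "\<And>i. i < l \<Longrightarrow> c i = 0" "l \<le> N"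
  proof -
    obtain j where j: "j \<le> N" "c j \<noteq> 0" using c(1) by auto
    show "c l \<noteq> 0" unfolding l_def by (rule LeastI[of "\<lambda>i. c i \<noteq> 0", OF j(2)])
    show "c i = 0" if "i < l" for i using not_less_Least[of i "\<lambda>i. c i \<noteq> 0"] that unfolding l_def by blast
    show "l \<le> N" using Least_le[of "\<lambda>i. c i \<noteq> 0" j] j unfolding l_def by simp
  qed
  have "\<not> valuation_ring.small V x" if V: "padic_valuation_ring V p" and p: "\<not> p dvd nat \<bar>c l\<bar>" for V p
  proof
    interpret padic_valuation_ring V p by fact
    assume x: "small x"
    have "x ^ l * (\<Sum>i\<in>{l..N}. of_int (c i) * x ^ (i - l)) = (\<Sum>i\<in>{l..N}. of_int (c i) * x ^ i)"
      unfolding sum_distrib_left by (intro sum.cong) (auto simp flip: power_add)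
    also have "\<dots> = (\<Sum>i\<le>N. of_int (c i) * x ^ i)"
      using l(2) by (intro sum.mono_neutral_left) auto
    finally have "(\<Sum>i\<in>{l..N}. of_int (c i) * x ^ (i - l)) = 0" using c(2) \<open>x \<noteq> 0\<close> by simp
    then have "of_int (c l) + (\<Sum>i\<in>{l..N} - {l}. of_int (c i) * x ^ (i - l)) = 0"
      using l(3) sum.remove[of "{l..N}" l "\<lambda>i. of_int (c i) * x ^ (i - l)"] by simp
    moreover have "small (\<Sum>i\<in>{l..N} - {l}. of_int (c i) * x ^ (i - l))"
      using x by (intro small_sum small_mult' small_power) auto
    moreover have "unit (of_int (c l))"
      using p by (simp add: unit_of_int_iff)
    ultimately show False using unit_add_small unit_nonzero by blast
  qed
  moreover have "nat \<bar>c l\<bar> > 0" using l by simp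
  ultimately show ?thesis by blast
qed

text \<open>A nonzero x is a unit once neither x nor 1/x is small, and both of them lie in
  K.\<close>

lemma units_almost_everywhere:
  assumes K: "subfield_set K" "\<And>x. x \<in> K \<Longrightarrow> int_relation N x"
    and "finite S" "S \<subseteq> K - {0}"
  shows "\<exists>M>0. \<forall>V p. padic_valuation_ring V p \<longrightarrow> \<not> p dvd M \<longrightarrow> (\<forall>x\<in>S. valuation_ring.unit V x)"
  using assms(3,4)
proof (induction S rule: finite_induct)
  case (insert x S)
  then obtain M where M: "M > 0" "\<forall>V p. padic_valuation_ring V p \<longrightarrow> \<not> p dvd M \<longrightarrow> (\<forall>x\<in>S. valuation_ring.unit V x)"
    by auto
  obtain M1 where M1: "M1 > 0" "\<forall>V p. padic_valuation_ring V p \<longrightarrow> \<not> p dvd M1 \<longrightarrow> \<not> valuation_ring.small V x"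
    using int_relation_not_small[OF K(2)] insert.prems by blast
  obtain M2 where M2: "M2 > 0" "\<forall>V p. padic_valuation_ring V p \<longrightarrow> \<not> p dvd M2 \<longrightarrow> \<not> valuation_ring.small V (inverse x)"
    using int_relation_not_small[OF K(2)[OF subfield_setD(10)[OF K(1)]], of x] insert.prems by auto
  have "valuation_ring.unit V y" if V: "padic_valuation_ring V p" "\<not> p dvd M * M1 * M2" "y \<in> insert x S" for V p y
  proof -
    interpret padic_valuation_ring V p by fact
    have "\<not> p dvd M" "\<not> p dvd M1" "\<not> p dvd M2" using that(2) by auto
    then show ?thesis
      using M(2) M1(2) M2(2) V(1,3) small_or_small_inverse[of x] insert.prems by auto
  qed
  moreover have "M * M1 * M2 > 0" using M M1 M2 by simp
  ultimately show ?case by blast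
qed auto

section \<open>Discreteness of the valuation on K\<close>

lemma (in valuation_ring) unit_power_int_iff:
  assumes "small a" "a \<noteq> 0"
  shows "unit (a powi k) \<longleftrightarrow> k = 0"
proof
  assume u: "unit (a powi k)"
  show "k = 0"
  proof (rule ccontr)
    assume "k \<noteq> 0"
    have "unit (a ^ nat \<bar>k\<bar>)"
      using u unit_inverse[OF u] by (cases "k \<ge> 0") (auto simp: power_int_def power_inverse)
    then show False
      using small_power[OF assms(1), of "nat \<bar>k\<bar>"] \<open>k \<noteq> 0\<close> not_unit_small by auto
  qed
qed auto

context padic_valuation_ring
begin

text \<open>Two terms of the relation have equal value, and the coefficients have the values of
  powers of p. Hence (j - i) v(x) is an integer multiple of v(p) with 0 < |j - i| <= N, and |j - i|
  divides N!.\<close>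

lemma int_relation_power_associated:
  assumes "int_relation N x" "x \<noteq> 0"
  shows "\<exists>k::int. unit (x ^ fact N / of_nat p powi k)"
proof -
  obtain c where c: "\<exists>i\<le>N. c i \<noteq> 0" "(\<Sum>i\<le>N. of_int (c i) * x ^ i) = 0"
    using assms by (auto simp: int_relation_def)
  define I where "I = {i. i \<le> N \<and> c i \<noteq> 0}"
  have "(\<Sum>i\<in>I. of_int (c i) * x ^ i) = 0"
    using c(2) by (subst sum.mono_neutral_left[of "{..N}"]) (auto simp: I_def)
  then obtain i j where ij: "i \<in> I" "j \<in> I" "i \<noteq> j" "unit (of_int (c i) * x ^ i / (of_int (c j) * x ^ j))"
    using c(1) \<open>x \<noteq> 0\<close> by (elim sum_zero_imp_associated[rotated 3]) (auto simp: I_def)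
  have p0: "(of_nat p :: 'a) \<noteq> 0" using prime by auto
  have unit_part: "\<exists>a. unit (of_int d / of_nat p ^ a)" if d0: "d \<noteq> 0" for d :: int
  proof -
    have "\<not> is_unit (int p)" using prime by (simp add: prime_int_iff prime_nat_iff)
    then obtain y where y: "d = int p ^ multiplicity (int p) d * y" "\<not> int p dvd y"
      by (rule multiplicity_decompose'[OF d0])
    then have "(of_int d :: 'a) = of_int (int p ^ multiplicity (int p) d * y)" by simp
    then have "of_int d / of_nat p ^ multiplicity (int p) d = (of_int y :: 'a)"
      using p0 by simp
    then show ?thesis using y(2) unit_of_int_iff by metis
  qed
  obtain a b where ab: "unit (of_int (c i) / of_nat p ^ a)" "unit (of_int (c j) / of_nat p ^ b)"
    using unit_part ij(1,2) unfolding I_def by blast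
  have ex: "\<exists>k::int. unit (x ^ fact N / of_nat p powi k)"
    if "i < j" "j \<le> N" "unit (u / of_nat p ^ a)" "unit (v / of_nat p ^ b)" "unit (u * x ^ i / (v * x ^ j))"
    for i j a b u v
  proof -
    have nz: "u \<noteq> 0" "v \<noteq> 0" using that by (auto simp: unit_def)
    have "unit ((u / of_nat p ^ a) / (v / of_nat p ^ b) / (u * x ^ i / (v * x ^ j)))"
      by (rule unit_divide[OF unit_divide[OF that(3,4)] that(5)])
    also have "(u / of_nat p ^ a) / (v / of_nat p ^ b) / (u * x ^ i / (v * x ^ j)) =
        x ^ (j - i) / of_nat p powi (int a - int b)"
      using nz p0 \<open>x \<noteq> 0\<close> \<open>i < j\<close> by (simp add: power_diff power_int_diff field_simps)
    finally have u: "unit (x ^ (j - i) / of_nat p powi (int a - int b))" .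
    have "(j - i) dvd fact N" using that by (intro dvd_fact) auto
    then obtain q where q: "fact N = (j - i) * q" by auto
    have "unit ((x ^ (j - i) / of_nat p powi (int a - int b)) ^ q)" using u by (rule unit_power)
    also have "(x ^ (j - i) / of_nat p powi (int a - int b)) ^ q =
        x ^ fact N / of_nat p powi ((int a - int b) * int q)"
      by (simp add: q power_divide power_mult power_int_mult)
    finally show ?thesis by blast
  qed
  show ?thesis
  proof (cases "i < j")
    case True
    then show ?thesis using ex[OF True _ ab ij(4)] ij(2) by (auto simp: I_def)
  next
    case False
    have u: "unit (of_int (c j) * x ^ j / (of_int (c i) * x ^ i))"
      using unit_inverse[OF ij(4)] by simp
    show ?thesis using ex[OF _ _ ab(2,1) u] ij(1,3) False by (auto simp: I_def)
  qed
qed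

lemma ex_uniformizer:
  assumes K: "subfield_set K" "\<And>x. x \<in> K \<Longrightarrow> int_relation N x"
  obtains \<pi> where "\<pi> \<in> K" "\<pi> \<noteq> 0" "small \<pi>" "\<pi> ^ fact N / of_nat p \<in> V"
    "\<And>x. x \<in> K \<Longrightarrow> x \<noteq> 0 \<Longrightarrow> \<exists>k::int. unit (x / \<pi> powi k)"
proof -
  note Kcl = subfield_setD[OF K(1)]
  have p0: "(of_nat p :: 'a) \<noteq> 0" using prime by auto
  \<comment> \<open>This is N! times the value of x, normalised so that p has value 1; it is an
    integer.\<close>
  define v where "v x = (SOME k::int. unit (x ^ fact N / of_nat p powi k))" for x
  have v: "unit (x ^ fact N / of_nat p powi v x)" if "x \<in> K" "x \<noteq> 0" for x
    unfolding v_def using int_relation_power_associated[OF K(2)[OF that(1)] that(2)] by (rule someI_ex)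
  have v_unique: "k = v x" if "x \<in> K" "x \<noteq> 0" "unit (x ^ fact N / of_nat p powi k)" for x k
  proof -
    have "unit ((x ^ fact N / of_nat p powi v x) / (x ^ fact N / of_nat p powi k))"
      by (rule unit_divide[OF v[OF that(1,2)] that(3)])
    also have "(x ^ fact N / of_nat p powi v x) / (x ^ fact N / of_nat p powi k) = of_nat p powi (k - v x)"
      using that p0 by (simp add: power_int_diff field_simps)
    finally show ?thesis using unit_power_int_iff[OF small_p p0] by simp
  qed
  \<comment> \<open>The positive integers taken by v on K; N! is one of them, as v(p) = N!.\<close>
  define P where "P k \<longleftrightarrow> k > 0 \<and> (\<exists>x\<in>K. x \<noteq> 0 \<and> v x = int k)" for k :: nat
  define m where "m = (LEAST k. P k)"
  have "v (of_nat p) = int (fact N)"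
  proof (rule v_unique[symmetric])
    show "unit (of_nat p ^ fact N / of_nat p powi int (fact N))"
      unfolding power_int_of_nat using p0 by simp
  qed (use p0 Kcl(8) in auto)
  then have "P (fact N)"
    unfolding P_def using p0 Kcl(8) by (auto intro!: bexI[of _ "of_nat p"])
  then have "P m" and m_min: "\<And>k. P k \<Longrightarrow> m \<le> k"
    unfolding m_def by (auto intro: LeastI Least_le)
  then have m: "m > 0" "\<exists>x\<in>K. x \<noteq> 0 \<and> v x = int m"
    by (auto simp: P_def)
  then obtain \<pi> where \<pi>: "\<pi> \<in> K" "\<pi> \<noteq> 0" "v \<pi> = int m" by auto
  have \<pi>_unit: "unit (\<pi> ^ fact N / of_nat p ^ m)" using v[OF \<pi>(1,2)] \<pi>(3) by simp
  \<comment> \<open>Since m >= 1, the element \<pi>^(N!), which is a unit times p^m, is divisible by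
    p.\<close>
  have "\<pi> ^ fact N / of_nat p = \<pi> ^ fact N / of_nat p ^ m * of_nat p ^ (m - 1)"
    using p0 m(1) by (cases m) auto
  then have mem: "\<pi> ^ fact N / of_nat p \<in> V"
    using mult_mem[OF unit_mem[OF \<pi>_unit] power_mem[OF of_nat_mem]] by simp
  have "small (of_nat p * (\<pi> ^ fact N / of_nat p))" by (rule small_mult[OF small_p mem])
  then have s: "small (\<pi> ^ fact N)" using p0 by simp
  have "small \<pi>"
    by (rule small_if_power_small[OF s mem_if_power_mem[OF small_mem[OF s]]]) simp
  moreover have "\<exists>k::int. unit (x / \<pi> powi k)" if x: "x \<in> K" "x \<noteq> 0" for x
  proof -
    \<comment> \<open>Division with remainder: x / \<pi>^q is an element of K with v = r < m, so r =
      0 by minimality of m.\<close>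
    define q r where "q = v x div int m" and "r = v x mod int m"
    define y where "y = x / \<pi> powi q"
    have y: "y \<in> K" "y \<noteq> 0" using x \<pi> Kcl by (auto simp: y_def)
    have "unit ((x ^ fact N / of_nat p powi v x) / (\<pi> ^ fact N / of_nat p ^ m) powi q)"
      by (rule unit_divide[OF v[OF x] unit_power_int[OF \<pi>_unit]])
    also have "(x ^ fact N / of_nat p powi v x) / (\<pi> ^ fact N / of_nat p ^ m) powi q =
        y ^ fact N / of_nat p powi r"
    proof -
      have "v x = int m * q + r" by (simp add: q_def r_def)
      then have "of_nat p powi v x = (of_nat p ^ m) powi q * (of_nat p powi r :: 'a)"
        using p0 by (simp add: power_int_add power_int_mult)
      moreover have "(\<pi> powi q) ^ fact N = (\<pi> ^ fact N) powi q"
        by (metis power_int_mult mult.commute power_int_of_nat)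
      ultimately show ?thesis
        using p0 \<pi>(2) by (simp add: y_def power_divide power_int_divide_distrib field_simps)
    qed
    finally have r: "v y = r" using v_unique[OF y] by simp
    have "r = 0"
    proof (rule ccontr)
      assume "r \<noteq> 0"
      then have "r > 0" "r < int m" using m(1) pos_mod_sign[of "int m" "v x"] pos_mod_bound[of "int m" "v x"]
        unfolding r_def by linarith+
      moreover have "P (nat r)"
        unfolding P_def using y r \<open>r > 0\<close> by auto
      ultimately show False using m_min[of "nat r"] by linarith
    qed
    then have "unit (y ^ fact N)" using v[OF y] r by simp
    then have "unit y" by (rule unit_if_power_unit) simp
    then show ?thesis unfolding y_def by blast
  qed
  ultimately show ?thesis using that[OF \<pi>(1,2) _ mem] by blast
qed

end

section \<open>Kummer extensions\<close>

definition independent_powers :: "'a::field set \<Rightarrow> nat \<Rightarrow> 'a \<Rightarrow> bool" where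
  "independent_powers K n x \<longleftrightarrow>
     (\<forall>c. (\<forall>i. c i \<in> K) \<longrightarrow> (\<Sum>i<n. c i * x ^ i) = 0 \<longrightarrow> (\<forall>i<n. c i = 0))"

lemma independent_powersD:
  assumes "independent_powers K n x" "0 \<in> K" "\<And>i. i < n \<Longrightarrow> c i \<in> K" "(\<Sum>i<n. c i * x ^ i) = 0" "i < n"
  shows "c i = 0"
proof -
  define c' where "c' i = (if i < n then c i else 0)" for i
  have "(\<Sum>i<n. c' i * x ^ i) = 0" using assms(4) by (simp add: c'_def)
  moreover have "\<forall>i. c' i \<in> K" using assms(2,3) by (simp add: c'_def)
  ultimately have "c' i = 0"
    using assms(1,5) unfolding independent_powers_def by blast
  then show ?thesis using assms(5) by (simp add: c'_def)
qed

text \<open>Independence of the powers of t below n takes the place of irreducibility of X^n - t^n;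
  in the application it is read off from values.\<close>

locale kummer =
  fixes K :: "complex set" and n :: nat and t :: complex
  assumes K: "subfield_set K" and n: "n > 1" and roots: "\<And>z. z ^ n = 1 \<Longrightarrow> z \<in> K"
    and t_power: "t ^ n \<in> K" and t_nonzero: "t \<noteq> 0" and indep: "independent_powers K n t"
begin

lemmas K_closed = subfield_setD[OF K]

lemma K_subring: "subring_set K"
  using K by (simp add: subfield_set_def)

definition L :: "complex set" where
  "L = adjoin K t"

lemma subring_L: "subring_set L"
  unfolding L_def by (rule subring_set_adjoin[OF K_subring])

lemmas L_closed = subring_setD[OF subring_L]

lemma K_subset_L: "K \<subseteq> L" and t_in_L: "t \<in> L"
  unfolding L_def using subset_adjoin[OF K_subring] mem_adjoin[OF K_subring] by auto

text \<open>Reduction modulo X^n - t^n. The remainder is the same for all conjugates \<omega> t,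
  which makes conjugation well defined.\<close>

lemma poly_reduce:
  assumes "\<forall>i. coeff q i \<in> K"
  shows "\<exists>r. (\<forall>i. r i \<in> K) \<and> (\<forall>\<omega>. \<omega> ^ n = 1 \<longrightarrow> poly q (\<omega> * t) = (\<Sum>i<n. r i * (\<omega> * t) ^ i))"
  using assms
proof (induction q)
  case 0
  show ?case using K_closed(2) by (intro exI[of _ "\<lambda>_. 0"]) auto
next
  case (pCons a q)
  have "a \<in> K" using pCons.prems[rule_format, of 0] by simp
  have "\<forall>i. coeff q i \<in> K"
  proof
    fix i show "coeff q i \<in> K" using pCons.prems[rule_format, of "Suc i"] by simp
  qed
  then obtain r where r: "\<And>i. r i \<in> K" "\<And>\<omega>. \<omega> ^ n = 1 \<Longrightarrow> poly q (\<omega> * t) = (\<Sum>i<n. r i * (\<omega> * t) ^ i)"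
    using pCons.IH by blast
  obtain m where m: "n = Suc m" using n by (cases n) auto
  define r' where "r' i = (case i of 0 \<Rightarrow> a + r m * t ^ n | Suc j \<Rightarrow> r j)" for i
  have "r' i \<in> K" for i
    using r(1) \<open>a \<in> K\<close> t_power K_closed by (auto simp: r'_def split: nat.split)
  moreover have "poly (pCons a q) (\<omega> * t) = (\<Sum>i<n. r' i * (\<omega> * t) ^ i)" if "\<omega> ^ n = 1" for \<omega>
  proof -
    have "poly (pCons a q) (\<omega> * t) = a + (\<Sum>i<n. r i * (\<omega> * t) ^ Suc i)"
      by (simp add: r(2)[OF that] sum_distrib_left algebra_simps)
    also have "(\<Sum>i<n. r i * (\<omega> * t) ^ Suc i) = (\<Sum>i<m. r i * (\<omega> * t) ^ Suc i) + r m * (\<omega> * t) ^ n"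
      by (simp add: m)
    also have "(\<omega> * t) ^ n = t ^ n" using that by (simp add: power_mult_distrib)
    also have "a + ((\<Sum>i<m. r i * (\<omega> * t) ^ Suc i) + r m * t ^ n) = (\<Sum>i<n. r' i * (\<omega> * t) ^ i)"
      unfolding m sum.lessThan_Suc_shift by (simp add: r'_def m)
    finally show ?thesis .
  qed
  ultimately show ?case by blast
qed

lemma mem_L_iff: "x \<in> L \<longleftrightarrow> (\<exists>r. (\<forall>i. r i \<in> K) \<and> x = (\<Sum>i<n. r i * t ^ i))"
proof
  assume "x \<in> L"
  then obtain q where "\<forall>i. coeff q i \<in> K" "x = poly q t" by (auto simp: L_def adjoin_def)
  then show "\<exists>r. (\<forall>i. r i \<in> K) \<and> x = (\<Sum>i<n. r i * t ^ i)"
    using poly_reduce[of q] by (metis mult_1 power_one)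
next
  assume "\<exists>r. (\<forall>i. r i \<in> K) \<and> x = (\<Sum>i<n. r i * t ^ i)"
  then show "x \<in> L" using K_subset_L t_in_L by (auto intro!: L_closed(9,4,7))
qed

lemma dimension_L: "CC.dimension n K L"
proof -
  have "CC.dimension m K {(\<Sum>i<m. r i * t ^ i) | r. \<forall>i. r i \<in> K}" if "m \<le> n" for m
    using that
  proof (induction m)
    case 0
    have "{(\<Sum>i<0. r i * t ^ i) | r. \<forall>i::nat. r i \<in> K} = {0}" using K_closed(2) by auto
    then show ?case using CC.dimension.zero_dim by simp
  next
    case (Suc m)
    define E where "E = {(\<Sum>i<m. r i * t ^ i) | r. \<forall>i. r i \<in> K}"
    have "t ^ m \<notin> E"
    proof
      assume "t ^ m \<in> E"
      then obtain r where r: "\<forall>i. r i \<in> K" "t ^ m = (\<Sum>i<m. r i * t ^ i)" by (auto simp: E_def)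
      define c where "c i = (if i < m then r i else if i = m then - 1 else 0)" for i
      have "(\<Sum>i<n. c i * t ^ i) = (\<Sum>i<Suc m. c i * t ^ i)"
        using Suc.prems by (intro sum.mono_neutral_right) (auto simp: c_def)
      also have "\<dots> = 0" using r(2) by (simp add: c_def)
      finally have "(\<Sum>i<n. c i * t ^ i) = 0" .
      moreover have "c i \<in> K" for i using r(1) K_closed(1,2,5) by (auto simp: c_def)
      ultimately have "c m = 0"
        using Suc.prems by (intro independent_powersD[OF indep K_closed(2), of c]) auto
      then show False by (simp add: c_def)
    qed
    then have "CC.dimension (Suc m) K (CC.line_extension K (t ^ m) E)"
      using Suc by (intro CC.dimension.Suc_dim) (auto simp: E_def)
    also have "CC.line_extension K (t ^ m) E = {(\<Sum>i<Suc m. r i * t ^ i) | r. \<forall>i. r i \<in> K}"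
    proof (intro Set.set_eqI iffI)
      fix x assume "x \<in> CC.line_extension K (t ^ m) E"
      then obtain k r where kr: "k \<in> K" "\<forall>i. r i \<in> K" "x = k * t ^ m + (\<Sum>i<m. r i * t ^ i)"
        by (auto simp: line_extension_CC E_def)
      have "x = (\<Sum>i<Suc m. (r(m := k)) i * t ^ i)" using kr by simp
      then show "x \<in> {(\<Sum>i<Suc m. r i * t ^ i) | r. \<forall>i. r i \<in> K}"
        using kr(1,2) unfolding mem_Collect_eq by (intro exI[of _ "r(m := k)"]) auto
    next
      fix x assume "x \<in> {(\<Sum>i<Suc m. r i * t ^ i) | r. \<forall>i. r i \<in> K}"
      then obtain r where "\<forall>i. r i \<in> K" "x = r m * t ^ m + (\<Sum>i<m. r i * t ^ i)"
        by (auto simp: add.commute)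
      then show "x \<in> CC.line_extension K (t ^ m) E"
        unfolding line_extension_CC E_def by blast
    qed
    finally show ?case .
  qed
  moreover have "L = {(\<Sum>i<n. r i * t ^ i) | r. \<forall>i. r i \<in> K}"
    using mem_L_iff by blast
  ultimately show ?thesis by simp
qed

lemma subfield_L: "subfield_set L"
proof -
  have "inverse x \<in> L" if x: "x \<in> L" for x
  proof (cases "x = 0")
    case False
    \<comment> \<open>The n + 1 elements x, x t, ..., x t^(n-1) and 1 of the n-dimensional L are
      dependent, and 1 must occur in the relation.\<close>
    define f where "f i = (if i = n then 1 else x * t ^ i)" for i
    have "\<exists>c. (\<forall>i\<in>{..n}. c i \<in> K) \<and> (\<exists>i\<in>{..n}. c i \<noteq> 0) \<and> (\<Sum>i\<in>{..n}. c i * f i) = 0"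
      using x t_in_L L_closed(1,4,7) by (intro dimension_imp_dependent[OF dimension_L K]) (auto simp: f_def)
    then obtain c where c: "\<forall>i\<in>{..n}. c i \<in> K" "\<exists>i\<in>{..n}. c i \<noteq> 0" "(\<Sum>i\<in>{..n}. c i * f i) = 0"
      by blast
    have "{..n} = insert n {..<n}" by auto
    then have "c n + (\<Sum>i<n. c i * (x * t ^ i)) = 0"
      using c(3) by (simp add: f_def)
    then have rel: "c n + x * (\<Sum>i<n. c i * t ^ i) = 0"
      by (simp add: sum_distrib_left algebra_simps)
    have "c n \<noteq> 0"
    proof
      assume "c n = 0"
      then have "(\<Sum>i<n. c i * t ^ i) = 0" using rel False by simp
      then have "c i = 0" if "i < n" for i
        using that c(1) by (intro independent_powersD[OF indep K_closed(2), of c]) auto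
      then show False using c(2) \<open>c n = 0\<close> by (auto simp: le_less)
    qed
    then have "inverse x = - inverse (c n) * (\<Sum>i<n. c i * t ^ i)"
      using rel False by (simp add: field_simps) (metis add_eq_0_iff2 mult.commute)
    also have "\<dots> \<in> L"
      using c(1) K_closed(10,5) K_subset_L t_in_L by (intro L_closed(4,9,7)) auto
    finally show ?thesis .
  qed (use L_closed in auto)
  then show ?thesis using subring_L by (simp add: subfield_set_def)
qed

text \<open>The n powers of z and any x in L are n + 1 elements of an n-dimensional space, and x
  must occur in their relation. Thus the single number z generates L.\<close>

lemma L_subset_if_independent_powers:
  assumes M: "subfield_set M" "K \<subseteq> M" and z: "z \<in> M" "z \<in> L" "independent_powers K n z"
  shows "L \<subseteq> M"
proof
  fix x assume x: "x \<in> L"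
  note M_closed = subfield_setD[OF M(1)]
  define f where "f i = (if i = n then x else z ^ i)" for i
  have "\<exists>c. (\<forall>i\<in>{..n}. c i \<in> K) \<and> (\<exists>i\<in>{..n}. c i \<noteq> 0) \<and> (\<Sum>i\<in>{..n}. c i * f i) = 0"
    using x z(2) L_closed(7) by (intro dimension_imp_dependent[OF dimension_L K]) (auto simp: f_def)
  then obtain c where c: "\<forall>i\<in>{..n}. c i \<in> K" "\<exists>i\<in>{..n}. c i \<noteq> 0" "(\<Sum>i\<in>{..n}. c i * f i) = 0"
    by blast
  have "{..n} = insert n {..<n}" by auto
  then have rel: "c n * x + (\<Sum>i<n. c i * z ^ i) = 0"
    using c(3) by (simp add: f_def)
  have "c n \<noteq> 0"
  proof
    assume "c n = 0"
    then have "(\<Sum>i<n. c i * z ^ i) = 0" using rel by simp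
    then have "c i = 0" if "i < n" for i
      using that c(1) by (intro independent_powersD[OF z(3) K_closed(2), of c]) auto
    then show False using c(2) \<open>c n = 0\<close> by (auto simp: le_less)
  qed
  then have "x = - (\<Sum>i<n. c i * z ^ i) / c n"
    using rel by (simp add: field_simps add_eq_0_iff)
  also have "\<dots> \<in> M"
    using c(1) M(2) z(1) by (intro M_closed(5,9,11) M_closed(4,7)) auto
  finally show "x \<in> M" .
qed

section \<open>The automorphisms of a Kummer extension\<close>

definition galois_conj :: "complex \<Rightarrow> complex \<Rightarrow> complex" where
  "galois_conj \<omega> = (\<lambda>x\<in>L. poly (SOME q. (\<forall>i. coeff q i \<in> K) \<and> x = poly q t) (\<omega> * t))"

text \<open>Well-definedness: two polynomials over K that agree at t differ by one with remainder 0
  modulo X^n - t^n, so they agree at \<omega> t as well.\<close>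

lemma galois_conj_poly:
  assumes "\<omega> ^ n = 1" "\<forall>i. coeff q i \<in> K"
  shows "galois_conj \<omega> (poly q t) = poly q (\<omega> * t)"
proof -
  let ?P = "\<lambda>p. (\<forall>i. coeff p i \<in> K) \<and> poly q t = poly p t"
  define p where "p = (SOME p. ?P p)"
  have "?P p" unfolding p_def by (rule someI[of ?P q]) (use assms in auto)
  then have "\<forall>i. coeff (q - p) i \<in> K" "poly (q - p) t = 0"
    using assms(2) K_closed(3) by auto
  then obtain r where r: "\<And>i. r i \<in> K" "\<And>\<omega>. \<omega> ^ n = 1 \<Longrightarrow> poly (q - p) (\<omega> * t) = (\<Sum>i<n. r i * (\<omega> * t) ^ i)"
    using poly_reduce by blast
  have "(\<Sum>i<n. r i * t ^ i) = 0" using r(2)[of 1] \<open>poly (q - p) t = 0\<close> by simp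
  then have "r i = 0" if "i < n" for i
    using that r(1) by (intro independent_powersD[OF indep K_closed(2), of r]) auto
  then have "poly (q - p) (\<omega> * t) = 0" using r(2)[OF assms(1)] by simp
  moreover have "poly q t \<in> L" using assms(2) by (auto simp: L_def adjoin_def)
  ultimately show ?thesis by (simp add: galois_conj_def p_def)
qed

lemma galois_conj_sum:
  assumes "\<omega> ^ n = 1" "\<And>i. i < n \<Longrightarrow> r i \<in> K"
  shows "galois_conj \<omega> (\<Sum>i<n. r i * t ^ i) = (\<Sum>i<n. r i * \<omega> ^ i * t ^ i)"
proof -
  define q where "q = (\<Sum>i<n. monom (r i) i)"
  have "\<forall>i. coeff q i \<in> K"
    using assms(2) K_closed(2) by (auto simp: q_def coeff_sum intro!: K_closed(9))
  from galois_conj_poly[OF assms(1) this] show ?thesis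
    by (simp add: q_def poly_sum poly_monom power_mult_distrib algebra_simps)
qed

lemma galois_conj_hom:
  assumes "\<omega> ^ n = 1" "x \<in> L" "y \<in> L"
  shows "galois_conj \<omega> (x + y) = galois_conj \<omega> x + galois_conj \<omega> y" "galois_conj \<omega> (x * y) = galois_conj \<omega> x * galois_conj \<omega> y"
proof -
  obtain p q where pq: "\<forall>i. coeff p i \<in> K" "\<forall>i. coeff q i \<in> K" "x = poly p t" "y = poly q t"
    using assms(2,3) by (auto simp: L_def adjoin_def)
  have "\<forall>i. coeff (p + q) i \<in> K" "\<forall>i. coeff (p * q) i \<in> K"
    using pq K_closed(4,6) by (auto simp: coeff_mult intro!: K_closed(9))
  from this[THEN galois_conj_poly[OF assms(1)]] show
    "galois_conj \<omega> (x + y) = galois_conj \<omega> x + galois_conj \<omega> y" "galois_conj \<omega> (x * y) = galois_conj \<omega> x * galois_conj \<omega> y"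
    using galois_conj_poly[OF assms(1) pq(1)] galois_conj_poly[OF assms(1) pq(2)] by (simp_all add: pq(3,4))
qed

lemma galois_conj_K: "\<omega> ^ n = 1 \<Longrightarrow> x \<in> K \<Longrightarrow> galois_conj \<omega> x = x"
  using galois_conj_poly[of \<omega> "[:x:]"] K_closed(2) by (auto simp: coeff_pCons split: nat.split)

lemma galois_conj_t: "\<omega> ^ n = 1 \<Longrightarrow> galois_conj \<omega> t = \<omega> * t"
  using galois_conj_poly[of \<omega> "[:0, 1:]"] K_closed(1,2) by (auto simp: coeff_pCons split: nat.split)

lemma galois_conj_in_L: "\<omega> ^ n = 1 \<Longrightarrow> x \<in> L \<Longrightarrow> galois_conj \<omega> x \<in> L"
proof -
  assume \<omega>: "\<omega> ^ n = 1" and "x \<in> L"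
  then obtain r where "\<forall>i. r i \<in> K" "x = (\<Sum>i<n. r i * t ^ i)" by (auto simp: mem_L_iff)
  then show "galois_conj \<omega> x \<in> L"
    using galois_conj_sum[OF \<omega>, of r] roots[OF \<omega>] K_subset_L t_in_L by (auto intro!: L_closed(9,4,7))
qed

lemma galois_conj_conj:
  assumes "\<omega> ^ n = 1" "\<eta> ^ n = 1" "x \<in> L"
  shows "galois_conj \<omega> (galois_conj \<eta> x) = galois_conj (\<omega> * \<eta>) x"
proof -
  obtain r where r: "\<forall>i. r i \<in> K" "x = (\<Sum>i<n. r i * t ^ i)" using assms(3) by (auto simp: mem_L_iff)
  have "galois_conj \<omega> (\<Sum>i<n. (r i * \<eta> ^ i) * t ^ i) = (\<Sum>i<n. (r i * \<eta> ^ i) * \<omega> ^ i * t ^ i)"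
    using assms r roots[OF assms(2)] K_closed(4,7) by (intro galois_conj_sum) auto
  then show ?thesis
    using galois_conj_sum[OF assms(2), of r] galois_conj_sum[of "\<omega> * \<eta>" r] assms r
    by (simp add: power_mult_distrib mult_ac)
qed

lemma galois_conj_1: "x \<in> L \<Longrightarrow> galois_conj 1 x = x"
  using galois_conj_sum[of 1] by (auto simp: mem_L_iff)

lemma galois_conj_Bij: "\<omega> ^ n = 1 \<Longrightarrow> galois_conj \<omega> \<in> Bij L"
proof -
  assume \<omega>: "\<omega> ^ n = 1"
  then have \<omega>': "inverse \<omega> ^ n = 1" by (simp add: power_inverse)
  have "\<omega> \<noteq> 0" using \<omega> n by (auto simp: power_0_left)
  have "bij_betw (galois_conj \<omega>) L L"
    using \<omega> \<omega>' \<open>\<omega> \<noteq> 0\<close> galois_conj_in_L galois_conj_conj galois_conj_1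
    by (intro bij_betw_byWitness[of _ "galois_conj (inverse \<omega>)"]) auto
  then show ?thesis by (auto simp: Bij_def galois_conj_def)
qed

text \<open>An automorphism over K is determined by the image of t, which must be a root of X^n -
  t^n.\<close>

lemma carrier_galois_group: "carrier (galois_group K L) = galois_conj ` {\<omega>. \<omega> ^ n = 1}"
proof (intro Set.set_eqI iffI)
  fix s assume "s \<in> galois_conj ` {\<omega>. \<omega> ^ n = 1}"
  then obtain \<omega> where \<omega>: "\<omega> ^ n = 1" "s = galois_conj \<omega>" by auto
  then show "s \<in> carrier (galois_group K L)"
    using galois_conj_Bij galois_conj_hom galois_conj_K galois_conj_in_L K_closed(1)
    by (auto simp: galois_group_def ring_hom_def)
next
  fix s assume "s \<in> carrier (galois_group K L)"
  then have s: "s \<in> extensional L" "\<And>x. x \<in> L \<Longrightarrow> s x \<in> L" "\<And>x. x \<in> K \<Longrightarrow> s x = x"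
    "\<And>x y. x \<in> L \<Longrightarrow> y \<in> L \<Longrightarrow> s (x + y) = s x + s y" "\<And>x y. x \<in> L \<Longrightarrow> y \<in> L \<Longrightarrow> s (x * y) = s x * s y"
    by (auto simp: galois_group_def ring_hom_def Bij_def)
  have pow: "s (t ^ i) = s t ^ i" for i
  proof (induction i)
    case 0 show ?case using s(3)[OF K_closed(1)] by simp
  next
    case (Suc i) then show ?case using s(5)[OF t_in_L L_closed(7)[OF t_in_L]] by simp
  qed
  define \<omega> where "\<omega> = s t / t"
  have "s t ^ n = t ^ n" using pow[of n] s(3)[OF t_power] by simp
  then have \<omega>: "\<omega> ^ n = 1" using t_nonzero by (simp add: \<omega>_def power_divide)
  have "s x = galois_conj \<omega> x" for x
  proof (cases "x \<in> L")
    case True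
    then obtain r where r: "\<forall>i. r i \<in> K" "x = (\<Sum>i<n. r i * t ^ i)" by (auto simp: mem_L_iff)
    have "s (\<Sum>i<m. r i * t ^ i) = (\<Sum>i<m. r i * s t ^ i)" for m
    proof (induction m)
      case 0 show ?case using s(3)[OF K_closed(2)] by simp
    next
      case (Suc m)
      have "(\<Sum>i<m. r i * t ^ i) \<in> L" "r m \<in> L" "t ^ m \<in> L"
        using r(1) K_subset_L t_in_L by (auto intro!: L_closed(9,4,7))
      then show ?case using Suc s(3)[of "r m"] s(4,5) pow r(1) L_closed(4) by simp
    qed
    then show ?thesis using galois_conj_sum[OF \<omega>, of r] r t_nonzero by (simp add: \<omega>_def power_divide)
  next
    case False
    then show ?thesis using s(1) by (simp add: galois_conj_def extensional_def)
  qed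
  then show "s \<in> galois_conj ` {\<omega>. \<omega> ^ n = 1}" using \<omega> by blast
qed

section \<open>The fixed field, cyclicity, and radicals inside a Kummer extension\<close>

definition zeta :: complex where
  "zeta = cis (2 * pi / real n)"

lemma zeta_power: "zeta ^ k = cis (2 * pi * real k / real n)"
  by (simp add: zeta_def DeMoivre mult_ac)

lemma zeta_bij: "bij_betw (\<lambda>k. zeta ^ k) {..<n} {\<omega>. \<omega> ^ n = 1}"
  unfolding zeta_power using n by (intro bij_betw_roots_unity) auto

lemma zeta_root: "zeta ^ n = 1"
  using n by (simp add: zeta_power)

lemma zeta_power_inj: "i < n \<Longrightarrow> j < n \<Longrightarrow> zeta ^ i = zeta ^ j \<Longrightarrow> i = j"
  using zeta_bij by (auto simp: bij_betw_def inj_on_def)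

lemma zeta_power_mod: "zeta ^ (k mod n) = zeta ^ k"
proof -
  have "zeta ^ k = zeta ^ (n * (k div n) + k mod n)" by simp
  also have "\<dots> = zeta ^ (k mod n)" by (simp only: power_add power_mult zeta_root) simp
  finally show ?thesis ..
qed

lemma galois_extension_L: "galois_extension K L"
proof -
  have "x \<in> K" if x: "x \<in> L" "\<forall>s\<in>carrier (galois_group K L). s x = x" for x
  proof -
    obtain r where r: "\<forall>i. r i \<in> K" "x = (\<Sum>i<n. r i * t ^ i)" using x(1) by (auto simp: mem_L_iff)
    have "galois_conj zeta x = x" using x(2) zeta_root by (auto simp: carrier_galois_group)
    \<comment> \<open>Invariance under the single automorphism given by \<open>zeta\<close> already
      kills every r i with 0 < i < n, because \<open>zeta\<close> is a primitive root of
      unity.\<close>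
    then have "(\<Sum>i<n. r i * (zeta ^ i - 1) * t ^ i) = 0"
      using galois_conj_sum[OF zeta_root, of r] r by (simp add: algebra_simps sum_subtractf)
    then have *: "r i * (zeta ^ i - 1) = 0" if "i < n" for i
      using that r(1) roots[OF zeta_root] K_closed
      by (intro independent_powersD[OF indep K_closed(2), of "\<lambda>i. r i * (zeta ^ i - 1)"]) auto
    have "r i = 0" if "i \<in> {..<n} - {0}" for i
      using *[of i] zeta_power_inj[of i 0] that by auto
    then have "x = r 0" unfolding r(2) using n by (subst sum.remove[of _ 0]) auto
    then show ?thesis using r(1) by simp
  qed
  moreover have "s x = x" if "x \<in> K" "s \<in> carrier (galois_group K L)" for s x
    using that galois_conj_K by (auto simp: carrier_galois_group)
  ultimately show ?thesis
    using K subfield_L K_subset_L dimension_L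
    by (auto simp: galois_extension_def subfield_CC_iff CC.finite_dimension_def)
qed

lemma cyclic_extension_L: "cyclic_extension n K L"
proof -
  define h where "h j = galois_conj (zeta ^ nat j)" for j :: int
  have root: "(zeta ^ k) ^ n = 1" for k
    by (metis mult.commute power_mult power_one zeta_root)
  have "h \<in> hom (integer_mod_group n) (galois_group K L)"
  proof (rule homI)
    fix i j assume ij: "i \<in> carrier (integer_mod_group n)" "j \<in> carrier (integer_mod_group n)"
    then have nn: "i \<ge> 0" "j \<ge> 0" using n by (auto simp: carrier_integer_mod_group)
    show "h i \<in> carrier (galois_group K L)"
      using root by (auto simp: h_def carrier_galois_group)
    have "zeta ^ nat ((i + j) mod int n) = zeta ^ nat i * zeta ^ nat j"
      using nn by (simp add: nat_mod_distrib nat_add_distrib zeta_power_mod power_add)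
    then have "h (i \<otimes>\<^bsub>integer_mod_group n\<^esub> j) = galois_conj (zeta ^ nat i * zeta ^ nat j)"
      by (simp add: h_def)
    also have "\<dots> = compose L (h i) (h j)"
    proof
      fix x show "galois_conj (zeta ^ nat i * zeta ^ nat j) x = compose L (h i) (h j) x"
        using galois_conj_conj[OF root root]
        by (cases "x \<in> L") (simp add: compose_def h_def, simp add: compose_def galois_conj_def)
    qed
    also have "\<dots> = h i \<otimes>\<^bsub>galois_group K L\<^esub> h j"
      using galois_conj_Bij[OF root] by (simp add: galois_group_def BijGroup_def h_def)
    finally show "h (i \<otimes>\<^bsub>integer_mod_group n\<^esub> j) = h i \<otimes>\<^bsub>galois_group K L\<^esub> h j" .
  qed
  moreover have "inj_on h (carrier (integer_mod_group n))"
  proof (rule inj_onI)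
    fix i j assume ij: "i \<in> carrier (integer_mod_group n)" "j \<in> carrier (integer_mod_group n)" "h i = h j"
    then have "zeta ^ nat i * t = zeta ^ nat j * t"
      using galois_conj_t[OF root] unfolding h_def by metis
    then have "zeta ^ nat i = zeta ^ nat j" using t_nonzero by simp
    then have "nat i = nat j" using ij n by (intro zeta_power_inj) (auto simp: carrier_integer_mod_group)
    then show "i = j" using ij n by (auto simp: carrier_integer_mod_group)
  qed
  moreover have "carrier (galois_group K L) \<subseteq> h ` carrier (integer_mod_group n)"
  proof
    fix s assume "s \<in> carrier (galois_group K L)"
    then obtain \<omega> where "\<omega> ^ n = 1" "s = galois_conj \<omega>" by (auto simp: carrier_galois_group)
    moreover have "\<omega> \<in> (\<lambda>k. zeta ^ k) ` {..<n}"
      using zeta_bij \<open>\<omega> ^ n = 1\<close> by (simp add: bij_betw_def)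
    ultimately obtain k where "k < n" "s = galois_conj (zeta ^ k)" by auto
    then show "s \<in> h ` carrier (integer_mod_group n)"
      using n by (auto simp: h_def carrier_integer_mod_group intro!: image_eqI[of _ _ "int k"])
  qed
  ultimately have "h \<in> iso (integer_mod_group n) (galois_group K L)"
    by (auto simp: iso_iff hom_def)
  then have "integer_mod_group n \<cong> galois_group K L" by (rule is_isoI)
  then have "galois_group K L \<cong> integer_mod_group n"
    by (rule group.iso_sym[OF group_integer_mod_group])
  then show ?thesis using galois_extension_L by (simp add: cyclic_extension_def)
qed

text \<open>s is an eigenvector of conjugation by \<open>zeta\<close>. The powers of t are
  eigenvectors with pairwise distinct eigenvalues, so only one of them can occur in s.\<close>

lemma nth_root_in_L:
  assumes "s \<in> L" "s ^ n \<in> K" "s \<noteq> 0"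
  obtains c j where "c \<in> K" "s = c * t ^ j"
proof -
  obtain r where r: "\<forall>i. r i \<in> K" "s = (\<Sum>i<n. r i * t ^ i)" using assms(1) by (auto simp: mem_L_iff)
  have pow: "galois_conj zeta (s ^ i) = galois_conj zeta s ^ i" for i
  proof (induction i)
    case 0 show ?case using galois_conj_K[OF zeta_root K_closed(1)] by simp
  next
    case (Suc i) then show ?case using galois_conj_hom(2)[OF zeta_root assms(1) L_closed(7)[OF assms(1)]] by simp
  qed
  define \<omega> where "\<omega> = galois_conj zeta s / s"
  have "galois_conj zeta s ^ n = s ^ n" using pow[of n] galois_conj_K[OF zeta_root assms(2)] by simp
  then have "\<omega> ^ n = 1" using assms(3) by (simp add: \<omega>_def power_divide)
  have "galois_conj zeta s = \<omega> * s" using assms(3) by (simp add: \<omega>_def)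
  then have "(\<Sum>i<n. r i * (zeta ^ i - \<omega>) * t ^ i) = 0"
    using galois_conj_sum[OF zeta_root, of r] r
    by (simp add: algebra_simps sum_subtractf sum_distrib_left)
  then have *: "r i * (zeta ^ i - \<omega>) = 0" if "i < n" for i
    using that r(1) roots[OF zeta_root] roots[OF \<open>\<omega> ^ n = 1\<close>] K_closed
    by (intro independent_powersD[OF indep K_closed(2), of "\<lambda>i. r i * (zeta ^ i - \<omega>)"]) auto
  obtain j where j: "j < n" "r j \<noteq> 0"
  proof -
    have "\<exists>j<n. r j \<noteq> 0"
    proof (rule ccontr)
      assume "\<not> (\<exists>j<n. r j \<noteq> 0)"
      then have "s = 0" unfolding r(2) by (intro sum.neutral) auto
      then show False using assms(3) by simp
    qed
    then show ?thesis using that by blast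
  qed
  have "r i = 0" if "i \<in> {..<n} - {j}" for i
    using *[of i] *[of j] j zeta_power_inj[of i j] that by auto
  then have "s = r j * t ^ j" unfolding r(2) using j(1) by (subst sum.remove[of _ j]) auto
  then show ?thesis using that r(1) by blast
qed

end

section \<open>Points of the formal group generating a Kummer extension\<close>

lemma power_int_power_commute: "(x powi d) ^ k = (x ^ k) powi d" for x :: "'a::field"
  by (metis power_int_mult mult.commute power_int_of_nat)

text \<open>\<open>p_dvd\<close> bounds the ramification: v(p) is at most E v(\<pi>).
  \<open>associated_pi_power\<close> says that v(\<pi>) generates the value group of K.\<close>

locale uniformized_valuation_ring = padic_valuation_ring V p for V :: "complex set" and p +
  fixes K :: "complex set" and \<pi> :: complex and E :: nat
  assumes K: "subfield_set K" and pi_K: "\<pi> \<in> K" and pi_nonzero: "\<pi> \<noteq> 0" and small_pi: "small \<pi>"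
    and p_dvd: "\<pi> ^ E / of_nat p \<in> V"
    and associated_pi_power: "\<And>x. x \<in> K \<Longrightarrow> x \<noteq> 0 \<Longrightarrow> \<exists>k::int. unit (x / \<pi> powi k)"
begin

lemmas K_closed = subfield_setD[OF K]

text \<open>The hypotheses say that the value of \<open>x\<close> has order \<open>n\<close> modulo the value group of \<open>K\<close>.\<close>

lemma not_associated_to_K:
  assumes x: "x \<noteq> 0" "b \<in> K" "b \<noteq> 0" "unit (x ^ n / (b ^ n * \<pi> powi r))" "coprime r (int n)"
    and y: "y \<in> K" "y \<noteq> 0" and d: "\<not> int n dvd d"
  shows "\<not> unit (y * x powi d)"
proof
  assume u: "unit (y * x powi d)"
  define c where "c = y * b powi d"
  have "c \<in> K" "c \<noteq> 0" using x y K_closed by (auto simp: c_def)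
  then obtain k where k: "unit (c / \<pi> powi k)" using associated_pi_power by blast
  \<comment> \<open>Up to units, x^n is b^n \<pi>^r and c = y b^d is \<pi>^k, so the n-th power of y
    x^d is \<pi>^(r d + k n). Being a unit, it must have exponent 0.\<close>
  have "unit ((y * x powi d) ^ n / (x ^ n / (b ^ n * \<pi> powi r)) powi d / (c / \<pi> powi k) ^ n)"
    by (intro unit_divide unit_power unit_power_int u k x(4))
  also have "(y * x powi d) ^ n / (x ^ n / (b ^ n * \<pi> powi r)) powi d / (c / \<pi> powi k) ^ n =
      \<pi> powi (r * d + k * int n)"
  proof -
    have "(\<pi> powi k) ^ n = \<pi> powi (k * int n)" by (simp add: power_int_mult)
    moreover have "(\<pi> powi r) powi d = \<pi> powi (r * d)" by (simp add: power_int_mult)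
    ultimately show ?thesis
      using x(1,3) y(2) pi_nonzero
      by (simp add: c_def power_mult_distrib power_divide power_int_divide_distrib
          power_int_mult_distrib power_int_power_commute power_int_add)
  qed
  finally have "r * d + k * int n = 0"
    using unit_power_int_iff[OF small_pi pi_nonzero] by simp
  then have "r * d = int n * (- k)" by (simp add: algebra_simps)
  then have "int n dvd r * d" by simp
  then have "int n dvd d"
    using x(5) by (simp add: coprime_dvd_mult_right_iff coprime_commute)
  then show False using d by simp
qed

text \<open>Two terms of a vanishing combination would have equal value, putting (i - j) v(x) into
  the value group of K with 0 < |i - j| < n. The parameter b is there to absorb the factor m of
  z(mP).\<close>

lemma independent_powersI:
  assumes x: "x \<noteq> 0" "b \<in> K" "b \<noteq> 0" "unit (x ^ n / (b ^ n * \<pi> powi r))" "coprime r (int n)"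
  shows "independent_powers K n x"
  unfolding independent_powers_def
proof (rule ccontr)
  assume "\<not> (\<forall>c. (\<forall>i. c i \<in> K) \<longrightarrow> (\<Sum>i<n. c i * x ^ i) = 0 \<longrightarrow> (\<forall>i<n. c i = 0))"
  then obtain c l where c: "\<forall>i. c i \<in> K" "(\<Sum>i<n. c i * x ^ i) = 0" "l < n" "c l \<noteq> 0" by blast
  define I where "I = {i. i < n \<and> c i \<noteq> 0}"
  have "(\<Sum>i\<in>I. c i * x ^ i) = (\<Sum>i<n. c i * x ^ i)"
    by (intro sum.mono_neutral_left) (auto simp: I_def)
  then have sum0: "(\<Sum>i\<in>I. c i * x ^ i) = 0" using c(2) by simp
  have I: "finite I" "I \<noteq> {}" "\<And>i. i \<in> I \<Longrightarrow> c i * x ^ i \<noteq> 0"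
    using c(3,4) x(1) by (auto simp: I_def)
  obtain i j where ij: "i \<in> I" "j \<in> I" "i \<noteq> j" "unit (c i * x ^ i / (c j * x ^ j))"
    using sum_zero_imp_associated[OF I sum0] by blast
  have nz: "c i / c j \<in> K" "c i / c j \<noteq> 0" using ij(1,2) c(1) K_closed(11) by (auto simp: I_def)
  have "c i * x ^ i / (c j * x ^ j) = c i / c j * x powi (int i - int j)"
    using x(1) by (simp add: power_int_diff)
  then have "unit (c i / c j * x powi (int i - int j))" using ij(4) by simp
  moreover have "\<not> int n dvd int i - int j"
  proof
    assume "int n dvd int i - int j"
    then have "int n \<le> \<bar>int i - int j\<bar>" using ij(3) by (intro zdvd_imp_le) auto
    then show False using ij(1,2) by (auto simp: I_def)
  qed
  ultimately show False using not_associated_to_K[OF x nz] by blast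
qed

text \<open>With q = n E, z^q is divisible by p. If p^a exactly divides i + 1, then i + 1 >= p^a >=
  (q + 1) a + 1 by Bernoulli's inequality, as p >= q + 2. So i > q a, and z^i is divisible by p^a
  with a positive power of z to spare.\<close>

lemma small_log_coefficient:
  assumes z: "unit (z ^ n / \<pi>)" and n: "n > 0" and p: "p > n * E + 1" and "i > 0"
  shows "small z" "small (z ^ i / of_nat (Suc i))"
proof -
  have "small (z ^ n)" using small_mult[OF small_pi unit_mem[OF z]] pi_nonzero by simp
  then show sz: "small z"
    using n mem_if_power_mem small_mem by (intro small_if_power_small[of z n]) blast+
  define q where "q = n * E"
  have "z ^ q / of_nat p = (z ^ n / \<pi>) ^ E * (\<pi> ^ E / of_nat p)"
    using pi_nonzero by (simp add: q_def power_mult power_divide)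
  then have zq: "z ^ q / of_nat p \<in> V"
    using mult_mem[OF power_mem[OF unit_mem[OF z]] p_dvd] by (rule ssubst)
  define a where "a = multiplicity p (Suc i)"
  obtain s where s: "Suc i = p ^ a * s" "\<not> p dvd s"
  proof (rule multiplicity_decompose'[of "Suc i" p])
    show "\<not> is_unit p" using prime by (simp add: prime_nat_iff)
  qed (auto simp: a_def)
  have us: "unit (inverse (of_nat s))" using s(2) unit_of_nat_iff by (intro unit_inverse) simp
  have bern: "p ^ b \<ge> (q + 1) * b + 1" for b
  proof (induction b)
    case (Suc b)
    have "(q + 1) * Suc b + 1 \<le> (q + 2) * ((q + 1) * b + 1)" by (simp add: algebra_simps)
    also have "\<dots> \<le> p * p ^ b" using Suc p by (intro mult_le_mono) (auto simp: q_def)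
    finally show ?case by simp
  qed auto
  have "s > 0" using s by (auto intro: Nat.gr0I)
  then have "Suc i \<ge> p ^ a" using s(1) by simp
  then have "i \<ge> (q + 1) * a" using bern[of a] by linarith
  then have less: "q * a < i" using \<open>i > 0\<close> by (cases "a = 0") (auto simp: algebra_simps)
  have "z ^ i = z ^ (i - q * a) * (z ^ q) ^ a"
    using less by (simp flip: power_add power_mult)
  then have "z ^ i / of_nat (Suc i) = z ^ (i - q * a) * ((z ^ q / of_nat p) ^ a * inverse (of_nat s))"
    unfolding s(1) by (simp add: power_divide field_simps)
  then show "small (z ^ i / of_nat (Suc i))"
    using small_mult[OF small_power[OF sz, of "i - q * a"]] less
      mult_mem[OF power_mem[OF zq] unit_mem[OF us]] by simp
qed

end

section \<open>From a point with the right value of z to a gain of rank\<close>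

lemma ec_coordinates_add:
  assumes L: "subfield_set L" and "A \<in> L" "ec_coordinates P \<subseteq> L" "ec_coordinates Q \<subseteq> L"
  shows "ec_coordinates (ec_add A P Q) \<subseteq> L"
proof -
  note cl = subfield_setD[OF L]
  show ?thesis
    using assms(2-) by (cases "(A, P, Q)" rule: ec_add.cases)
      (auto simp: Let_def intro!: cl(3,4,5,6,7,11,13))
qed

lemma ec_coordinates_mult:
  assumes L: "subfield_set L" and "A \<in> L" "ec_coordinates P \<subseteq> L"
  shows "ec_coordinates (ec_mult A m P) \<subseteq> L"
proof -
  have *: "ec_coordinates ((ec_add A P ^^ k) Infinity) \<subseteq> L" for k
  proof (induction k)
    case (Suc k)
    then show ?case using ec_coordinates_add[OF L assms(2,3)] by simp
  qed auto
  have "ec_coordinates (ec_neg Q) \<subseteq> L" if "ec_coordinates Q \<subseteq> L" for Q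
    using that subfield_setD(5)[OF L] by (cases Q) auto
  then show ?thesis using * by (simp add: ec_mult_def)
qed

lemma zcoord_in_subfield:
  assumes "subfield_set M" "ec_coordinates P \<subseteq> M"
  shows "zcoord P \<in> M"
  using assms subfield_setD(2,11)[OF assms(1)] by (cases P) auto

context uniformized_valuation_ring
begin

text \<open>L is itself Galois over K and contains the coordinates of mP. Conversely, every field
  over K containing them contains z(mP), whose powers below n are independent.\<close>

lemma kummer_gains_rank:
  assumes n: "n > 1" and roots: "\<And>z. z ^ n = 1 \<Longrightarrow> z \<in> K"
    and t: "t \<noteq> 0" "t ^ n \<in> K" "unit (t ^ n / \<pi> powi r)" "coprime r (int n)"
    and AB: "A \<in> K" "A \<in> V" "B \<in> V"
    and P: "y\<^sup>2 = x ^ 3 + A * x + B" "x \<in> adjoin K t" "y \<in> adjoin K t"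
    and z: "unit ((x / y) ^ n / \<pi>)" and w: "small (1 / y)" "y \<noteq> 0"
    and p: "p > n * E + 1"
  shows "kummer K n t" "gains_rank K A B (adjoin K t)"
proof -
  have "independent_powers K n t"
    using t K_closed(1) by (intro independent_powersI[of t 1 n r]) auto
  then show kum: "kummer K n t"
    using n roots t K by unfold_locales auto
  interpret kummer K n t by fact
  define P where "P = Affine x y"
  have log: "small (zcoord P)" "\<And>i. i > 0 \<Longrightarrow> small (zcoord P ^ i / of_nat (Suc i))"
    using small_log_coefficient[OF z _ p] n unfolding P_def zcoord.simps by (blast intro: zero_less_one, simp)
  have "galois_extension_generated K (ec_coordinates (ec_mult A m P)) = L" if m: "m \<noteq> 0" for m
  proof -
    have "unit (zcoord (ec_mult A m P) / (of_int m * zcoord P))"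
    proof (rule zcoord_ec_mult_near_infinity[OF AB(2,3) _ _ w(2) log(1) _ log(2) m])
      show "P \<in> ec_curve A B" using P by (simp add: P_def ec_curve_def ec_points_def)
    qed (use w in \<open>auto simp: P_def\<close>)
    then have u: "unit (zcoord (ec_mult A m P) / (of_int m * (x / y)))" by (simp add: P_def)
    define \<zeta> where "\<zeta> = zcoord (ec_mult A m P)"
    have nz: "x \<noteq> 0" "\<zeta> \<noteq> 0" using unit_nonzero[OF z] unit_nonzero[OF u] n by (auto simp: \<zeta>_def power_0_left)
    have mK: "(of_int m :: complex) \<in> K" using K_closed(5,8) by (cases m) (auto simp del: of_nat_Suc)
    \<comment> \<open>z(mP)^n is m^n \<pi> up to a unit, so \<open>independent_powersI\<close>
      applies with b = m and r = 1.\<close>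
    have "unit ((\<zeta> / (of_int m * (x / y))) ^ n * ((x / y) ^ n / \<pi>))"
      using u z unfolding \<zeta>_def by (intro unit_mult unit_power)
    also have "(\<zeta> / (of_int m * (x / y))) ^ n * ((x / y) ^ n / \<pi>) = \<zeta> ^ n / (of_int m ^ n * \<pi> powi 1)"
      using nz w(2) by (simp add: power_divide power_mult_distrib)
    finally have indep: "independent_powers K n \<zeta>"
      using nz(2) mK m by (intro independent_powersI[of \<zeta> "of_int m" n 1]) auto
    have coords: "ec_coordinates (ec_mult A m P) \<subseteq> L"
      using P AB(1) K_subset_L by (intro ec_coordinates_mult[OF subfield_L]) (auto simp: P_def L_def)
    have "L \<subseteq> M" if M: "galois_extension K M" "ec_coordinates (ec_mult A m P) \<subseteq> M" for M
    proof -
      have M': "subfield_set M" "K \<subseteq> M" using M(1) by (auto simp: galois_extension_def subfield_CC_iff)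
      show ?thesis
        using zcoord_in_subfield[OF M'(1) M(2)] zcoord_in_subfield[OF subfield_L coords] indep
        by (intro L_subset_if_independent_powers[OF M', of \<zeta>]) (auto simp: \<zeta>_def)
    qed
    then show ?thesis
      using galois_extension_L coords unfolding galois_extension_generated_def by blast
  qed
  moreover have "P \<in> ec_points A B L"
    using P by (auto simp: P_def ec_points_def L_def)
  ultimately show "gains_rank K A B (adjoin K t)"
    unfolding gains_rank_def L_def by blast
qed

end

section \<open>Explicit points\<close>

lemma (in valuation_ring) small_if_small_power: "small (x ^ k) \<Longrightarrow> k > 0 \<Longrightarrow> small x"
  using small_if_power_small mem_if_power_mem small_mem by blast

context uniformized_valuation_ring
begin

text \<open>The conditions that \<open>kummer_gains_rank\<close> puts on t and on the point. The
  exponent r depends on the construction (-3, -2, -5 or 1), whereas z^n is always \<pi> up to a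
  unit.\<close>

definition kummer_point :: "nat \<Rightarrow> complex \<Rightarrow> complex \<Rightarrow> complex \<Rightarrow> complex \<Rightarrow> complex \<Rightarrow> bool" where
  "kummer_point n A B t x y \<longleftrightarrow> t \<noteq> 0 \<and> t ^ n \<in> K \<and> (\<exists>r. unit (t ^ n / \<pi> powi r) \<and> coprime r (int n)) \<and>
     y\<^sup>2 = x ^ 3 + A * x + B \<and> x \<in> adjoin K t \<and> y \<in> adjoin K t \<and>
     unit ((x / y) ^ n / \<pi>) \<and> small (1 / y) \<and> y \<noteq> 0"

lemma K_subring: "subring_set K"
  using K by (simp add: subfield_set_def)

lemmas adjoin_closed = subring_setD[OF subring_set_adjoin[OF K_subring]]

lemma K_in_adjoin: "x \<in> K \<Longrightarrow> x \<in> adjoin K t"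
  using subset_adjoin[OF K_subring] by auto

lemma t_in_adjoin: "t \<in> adjoin K t"
  by (rule mem_adjoin[OF K_subring])

text \<open>Here \<open>x = a + \<delta>\<close> with \<open>\<delta>\<^sup>2 = D\<close>, where \<open>a\<close> and \<open>D\<close> make the trace of \<open>x\<^sup>3 + A x + B\<close> vanish;
  then \<open>y\<^sup>2 \<in> \<delta> K\<close>, so \<open>y\<close> is a fourth root of an element of \<open>K\<close>.\<close>

lemma quartic_point:
  assumes a: "a \<in> K" "a \<in> V" and AB: "A \<in> K" "A \<in> V" and D: "D \<in> K" "unit (D * \<pi>)"
    and eq: "a ^ 3 + 3 * a * D + A * a + B = 0"
  shows "\<exists>t x y. kummer_point 4 A B t x y"
proof -
  define \<delta> where "\<delta> = csqrt D"
  define \<beta> where "\<beta> = 3 * a\<^sup>2 + D + A"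
  define y where "y = csqrt (\<delta> * \<beta>)"
  have \<delta>2: "\<delta>\<^sup>2 = D" and y2: "y\<^sup>2 = \<delta> * \<beta>" by (simp_all add: \<delta>_def y_def)
  have "D \<noteq> 0" using unit_nonzero[OF D(2)] by simp
  then have "\<delta> \<noteq> 0" using \<delta>2 by auto
  have "unit (D * \<pi> + (3 * a\<^sup>2 + A) * \<pi>)"
    using D(2) small_pi a AB by (intro unit_add_small small_mult' add_mem mult_mem power_mem) auto
  then have \<beta>: "unit (\<beta> * \<pi>)" by (simp add: \<beta>_def algebra_simps)
  then have "\<beta> \<noteq> 0" using unit_nonzero by fastforce
  have \<beta>K: "\<beta> \<in> K" unfolding \<beta>_def using a AB D K_closed(4,6,7,13) by simp
  have y4: "y ^ 4 = D * \<beta>\<^sup>2"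
  proof -
    have "y ^ 4 = (y\<^sup>2)\<^sup>2" by simp
    then show ?thesis by (simp only: y2 power_mult_distrib \<delta>2)
  qed
  have "y \<noteq> 0" using y2 \<open>\<delta> \<noteq> 0\<close> \<open>\<beta> \<noteq> 0\<close> by auto
  have "small (\<pi> * inverse (D * \<pi>))"
    using small_pi unit_inverse[OF D(2)] by (intro small_mult unit_mem)
  also have "\<pi> * inverse (D * \<pi>) = (1 / \<delta>) ^ 2"
    using pi_nonzero \<open>D \<noteq> 0\<close> by (simp add: power_divide \<delta>2 field_simps)
  finally have "small (1 / \<delta>)" by (rule small_if_small_power) simp
  then have u: "unit (1 + a * (1 / \<delta>))"
    using a by (intro unit_add_small small_mult' unit_one)
  have zeq: "(a + \<delta>) ^ 4 = (1 + a * (1 / \<delta>)) ^ 4 * D\<^sup>2"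
  proof -
    have "a + \<delta> = (1 + a * (1 / \<delta>)) * \<delta>" using \<open>\<delta> \<noteq> 0\<close> by (simp add: field_simps)
    then have "(a + \<delta>) ^ 4 = (1 + a * (1 / \<delta>)) ^ 4 * (\<delta>\<^sup>2)\<^sup>2" by (simp only: power_mult_distrib) simp
    then show ?thesis by (simp only: \<delta>2)
  qed
  \<comment> \<open>Up to units, D and \<beta> are 1/\<pi> and x is \<delta>. So x^4 has the value
    of \<pi>^-2, y^4 = D \<beta>^2 that of \<pi>^-3, and z^4 that of \<pi>.\<close>
  have "unit ((1 + a * (1 / \<delta>)) ^ 4 * ((D * \<pi>) / (\<beta> * \<pi>)\<^sup>2))"
    by (intro u \<beta> unit_divide[OF D(2)] unit_power unit_mult)
  also have "(1 + a * (1 / \<delta>)) ^ 4 * ((D * \<pi>) / (\<beta> * \<pi>)\<^sup>2) = ((a + \<delta>) / y) ^ 4 / \<pi>"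
    unfolding power_divide zeq y4 using pi_nonzero \<open>D \<noteq> 0\<close> \<open>\<beta> \<noteq> 0\<close>
    by (simp add: field_simps power2_eq_square)
  finally have z: "unit (((a + \<delta>) / y) ^ 4 / \<pi>)" .
  have "unit ((D * \<pi>) * (\<beta> * \<pi>)\<^sup>2)" using D \<beta> by (intro unit_mult[OF D(2)] unit_power)
  then have t: "unit (y ^ 4 / \<pi> powi (- 3))"
    unfolding y4 using pi_nonzero
    by (simp add: power_int_minus field_simps power2_eq_square power3_eq_cube)
  have "small (\<pi> ^ 3 * inverse ((D * \<pi>) * (\<beta> * \<pi>)\<^sup>2))"
    using small_pi \<open>unit ((D * \<pi>) * (\<beta> * \<pi>)\<^sup>2)\<close> by (intro small_mult small_power unit_mem unit_inverse) auto
  also have "\<pi> ^ 3 * inverse ((D * \<pi>) * (\<beta> * \<pi>)\<^sup>2) = (1 / y) ^ 4"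
    unfolding power_divide y4 using pi_nonzero \<open>D \<noteq> 0\<close> \<open>\<beta> \<noteq> 0\<close>
    by (simp add: field_simps power2_eq_square power3_eq_cube)
  finally have w: "small (1 / y)" by (rule small_if_small_power) simp
  have "\<delta> = y * y * inverse \<beta>" using y2 \<open>\<beta> \<noteq> 0\<close> by (simp add: power2_eq_square)
  also have "\<dots> \<in> adjoin K y"
    using \<beta>K K_closed(10) by (intro adjoin_closed(4) t_in_adjoin K_in_adjoin) auto
  finally have \<delta>: "\<delta> \<in> adjoin K y" .
  have "y\<^sup>2 = (a + \<delta>) ^ 3 + A * (a + \<delta>) + B"
  proof -
    have "(a + \<delta>) ^ 3 + A * (a + \<delta>) + B =
      (a ^ 3 + 3 * a * \<delta>\<^sup>2 + A * a + B) + \<delta> * (3 * a\<^sup>2 + \<delta>\<^sup>2 + A)"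
      by (simp add: algebra_simps power2_eq_square power3_eq_cube)
    then show ?thesis by (simp add: y2 \<delta>2 eq \<beta>_def)
  qed
  moreover have "y ^ 4 \<in> K" unfolding y4 using D \<beta>K K_closed(4,7) by simp
  moreover have "coprime (- 3) (int 4)" by code_simp
  ultimately have "kummer_point 4 A B y (a + \<delta>) y"
    unfolding kummer_point_def using z t w \<open>y \<noteq> 0\<close> a \<delta> K_in_adjoin t_in_adjoin
    by (auto intro!: adjoin_closed(6))
  then show ?thesis by blast
qed

lemma exists_quartic_point:
  assumes AB: "A \<in> K" "B \<in> K" "A \<in> V" "B = 0 \<or> unit B" and 3: "unit 3"
  shows "\<exists>t x y. kummer_point 4 A B t x y"
proof (cases "B = 0")
  case True
  \<comment> \<open>With a = 0 and B = 0 the trace condition \<open>eq\<close> holds for every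
    D.\<close>
  show ?thesis
    using AB True pi_K pi_nonzero K_closed
    by (intro quartic_point[where a = 0 and D = "1 / \<pi>"]) auto
next
  case False
  \<comment> \<open>D solves the trace condition for a = \<pi>; as B is a unit, its value is
    -v(\<pi>).\<close>
  define D where "D = - (\<pi> ^ 3 + A * \<pi> + B) / (3 * \<pi>)"
  have "unit (B + (\<pi> ^ 3 + A * \<pi>))"
    using AB False small_pi by (intro unit_add_small small_add small_power small_mult') auto
  then have "unit (- ((B + (\<pi> ^ 3 + A * \<pi>)) / 3))"
    using 3 by (intro unit_uminus unit_divide)
  moreover have "D * \<pi> = - ((B + (\<pi> ^ 3 + A * \<pi>)) / 3)"
    using pi_nonzero by (simp add: D_def field_simps)
  ultimately have "unit (D * \<pi>)" by simp
  then show ?thesis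
    using AB pi_K pi_nonzero small_mem[OF small_pi] K_closed
    by (intro quartic_point[where a = \<pi> and D = D]) (auto simp: D_def)
qed

text \<open>The line \<open>y = s (x + g - a)\<close> meets the curve in three conjugate points; \<open>g\<close> is chosen so that
  the cubic for their \<open>x\<close>-coordinates, centred at \<open>a\<close>, is pure.\<close>

lemma cubic_point:
  assumes a: "a \<in> K" "a \<noteq> 0" "small a" and AB: "A \<in> K" "unit A" "B \<in> K" "B \<in> V"
    and 2: "unit 2" and 3: "unit 3" and s: "s\<^sup>2 = 3 * a"
  obtains c d g where "c ^ 3 = d" "d \<in> K" "d \<noteq> 0" "unit (d * a)" "g \<in> K"
    "(s * (g + c))\<^sup>2 = (a + c) ^ 3 + A * (a + c) + B" "s * (g + c) \<noteq> 0"
    "unit (((a + c) / (s * (g + c))) ^ 6 / a)" "small (1 / (s * (g + c)))"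
proof -
  have 6: "unit (6 :: complex)" using unit_mult[OF 2 3] by simp
  \<comment> \<open>Put x = a + c and y = s (g + c) into the curve equation: s^2 = 3 a matches the
    c^2-terms, this g matches the c-terms, and d is what remains for c^3.\<close>
  define g where "g = (3 * a\<^sup>2 + A) / (6 * a)"
  define d where "d = 3 * a * g\<^sup>2 - a ^ 3 - A * a - B"
  obtain c where c: "c ^ 3 = d" using nth_root_exists[of 3 d] by auto
  have aV: "a \<in> V" using a small_mem by simp
  have "unit ((A + 3 * a\<^sup>2) / 6)"
    using AB a 6 by (intro unit_divide unit_add_small small_mult' small_power) auto
  moreover have "g * a = (A + 3 * a\<^sup>2) / 6" using a by (simp add: g_def field_simps)
  ultimately have ga: "unit (g * a)" by (simp only:)
  have "g \<noteq> 0" using unit_nonzero[OF ga] by auto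
  have "unit (3 * (g * a)\<^sup>2 - (a * (a ^ 3 + A * a + B)))"
    using 3 ga a AB aV
    by (intro unit_diff_small unit_mult[OF 3] unit_power small_mult add_mem mult_mem power_mem unit_mem[OF AB(2)])
  moreover have "d * a = 3 * (g * a)\<^sup>2 - a * (a ^ 3 + A * a + B)"
    by (simp add: d_def algebra_simps power2_eq_square)
  ultimately have da: "unit (d * a)" by (simp only:)
  have "d \<noteq> 0" using unit_nonzero[OF da] by auto
  then have "c \<noteq> 0" using c by auto
  have gK: "g \<in> K" using a AB K_closed by (simp add: g_def)
  have dK: "d \<in> K" using a AB gK K_closed by (simp add: d_def)
  have "small (a * inverse (d * a))" using a da by (intro small_mult unit_mem unit_inverse)
  also have "a * inverse (d * a) = (1 / c) ^ 3"
    using a \<open>d \<noteq> 0\<close> by (simp add: power_divide c field_simps)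
  finally have "small (1 / c)" by (rule small_if_small_power) simp
  then have u: "unit (1 + a * (1 / c))"
    using aV by (intro unit_add_small small_mult' unit_one)
  have "small (a\<^sup>2 * ((d * a) / (g * a) ^ 3))"
    using a da ga by (intro small_mult small_power unit_mem unit_divide unit_power) auto
  also have "a\<^sup>2 * ((d * a) / (g * a) ^ 3) = (c / g) ^ 3"
    unfolding power_divide c using a \<open>g \<noteq> 0\<close> by (simp add: field_simps power2_eq_square power3_eq_cube)
  finally have "small (c / g)" by (rule small_if_small_power) simp
  then have v: "unit (1 + c / g)" by (intro unit_add_small unit_one)
  define y where "y = s * (g + c)"
  have y2: "y\<^sup>2 = 3 * a * g\<^sup>2 * (1 + c / g)\<^sup>2"
  proof -
    have "g + c = g * (1 + c / g)" using \<open>g \<noteq> 0\<close> by (simp add: field_simps)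
    then have "y\<^sup>2 = s\<^sup>2 * g\<^sup>2 * (1 + c / g)\<^sup>2" by (simp only: y_def power_mult_distrib mult.assoc)
    then show ?thesis by (simp only: s)
  qed
  have "1 + c / g \<noteq> 0" using unit_nonzero[OF v] .
  then have "y\<^sup>2 \<noteq> 0" unfolding y2 using a \<open>g \<noteq> 0\<close> by simp
  then have "y \<noteq> 0" by auto
  have curve: "y\<^sup>2 = (a + c) ^ 3 + A * (a + c) + B"
  proof -
    have e: "6 * a * g = 3 * a\<^sup>2 + A" using a by (simp add: g_def)
    have "y\<^sup>2 = 3 * a * g\<^sup>2 + (6 * a * g) * c + 3 * a * c\<^sup>2"
      unfolding y_def power_mult_distrib s by (simp add: algebra_simps power2_eq_square)
    also have "\<dots> = 3 * a * g\<^sup>2 - d + (3 * a\<^sup>2 + A) * c + 3 * a * c\<^sup>2 + c ^ 3"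
      unfolding e c by simp
    also have "\<dots> = (a + c) ^ 3 + A * (a + c) + B"
      unfolding d_def by (simp add: algebra_simps power2_eq_square power3_eq_cube)
    finally show ?thesis .
  qed
  have xeq: "(a + c) ^ 6 = (1 + a * (1 / c)) ^ 6 * d\<^sup>2"
  proof -
    have "a + c = (1 + a * (1 / c)) * c" using \<open>c \<noteq> 0\<close> by (simp add: field_simps)
    then have "(a + c) ^ 6 = (1 + a * (1 / c)) ^ 6 * (c ^ 3)\<^sup>2" by (simp only: power_mult_distrib) simp
    then show ?thesis by (simp only: c)
  qed
  have yeq: "y ^ 6 = 27 * a ^ 3 * g ^ 6 * (1 + c / g) ^ 6"
  proof -
    have "y ^ 6 = (y\<^sup>2) ^ 3" by simp
    then show ?thesis by (simp only: y2 power_mult_distrib) simp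
  qed
  have 27: "unit (27 :: complex)" using unit_power[OF 3, of 3] by simp
  have alg: "u * ((d * a)\<^sup>2 / (27 * ((g * a) ^ 6 * w))) = u * d\<^sup>2 / (27 * a ^ 3 * g ^ 6 * w) / a"
    if "w \<noteq> 0" for u w
  proof -
    have "(g * a) ^ 6 = g ^ 6 * a ^ 3 * a * a\<^sup>2"
      by (simp add: power_mult_distrib numeral_eq_Suc mult_ac)
    then show ?thesis using a \<open>g \<noteq> 0\<close> that by (simp add: power_mult_distrib)
  qed
  have alg': "a * inverse (3 * ((g * a)\<^sup>2 * w)) = 1 / (3 * a * g\<^sup>2 * w)" if "w \<noteq> 0" for w
    using a \<open>g \<noteq> 0\<close> that by (simp add: field_simps power2_eq_square)
  \<comment> \<open>In multiples of v(a), g and d have value -1, c has -1/3 and s has 1/2. So x = a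
    + c has -1/3, y = s (g + c) has -1/2, and z has 1/6.\<close>
  have "unit ((1 + a * (1 / c)) ^ 6 * ((d * a)\<^sup>2 / (27 * ((g * a) ^ 6 * (1 + c / g) ^ 6))))"
    by (intro u v da ga 27 unit_mult[OF 27] unit_divide unit_mult[OF unit_power[OF u]]
        unit_mult[OF unit_power[OF ga]] unit_power)
  also have "(1 + a * (1 / c)) ^ 6 * ((d * a)\<^sup>2 / (27 * ((g * a) ^ 6 * (1 + c / g) ^ 6))) =
      ((a + c) / y) ^ 6 / a"
    unfolding power_divide xeq yeq using \<open>1 + c / g \<noteq> 0\<close> by (intro alg) simp
  finally have z: "unit (((a + c) / y) ^ 6 / a)" .
  have "small (a * inverse (3 * ((g * a)\<^sup>2 * (1 + c / g)\<^sup>2)))"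
    by (intro small_mult a unit_mem unit_inverse unit_mult[OF 3] unit_mult[OF unit_power[OF ga]] unit_power v)
  also have "a * inverse (3 * ((g * a)\<^sup>2 * (1 + c / g)\<^sup>2)) = (1 / y)\<^sup>2"
    unfolding power_divide y2 power_one using \<open>1 + c / g \<noteq> 0\<close> by (intro alg') simp
  finally have "small (1 / y)" by (rule small_if_small_power) simp
  then show ?thesis
    using that[OF c dK \<open>d \<noteq> 0\<close> da gK] curve z \<open>y \<noteq> 0\<close> unfolding y_def by blast
qed

text \<open>For t = s c one has t^3 = M d s and t^4 = M^2 d c, so t recovers the square root s and
  the cube root c.\<close>

lemma sextic_radicals:
  assumes M: "M \<in> K" "M \<noteq> 0" and d: "d \<in> K" "d \<noteq> 0" and s: "s\<^sup>2 = M" and c: "c ^ 3 = d"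
  shows "(s * c) ^ 6 = M ^ 3 * d\<^sup>2" "s \<in> adjoin K (s * c)" "c \<in> adjoin K (s * c)"
proof -
  have p3: "(s * c) ^ 3 = M * d * s"
    unfolding s [symmetric] c [symmetric] by (simp add: power3_eq_cube power2_eq_square mult_ac)
  have p4: "(s * c) ^ 4 = M\<^sup>2 * d * c"
  proof -
    have "(s * c) ^ 4 = (s\<^sup>2)\<^sup>2 * c ^ 3 * c" by (simp add: power_mult_distrib power4_eq_xxxx power3_eq_cube power2_eq_square)
    then show ?thesis by (simp only: s c)
  qed
  have "(s * c) ^ 6 = (s\<^sup>2) ^ 3 * (c ^ 3)\<^sup>2" by (simp add: power_mult_distrib)
  then show "(s * c) ^ 6 = M ^ 3 * d\<^sup>2" by (simp only: s c)
  have "s = (s * c) ^ 3 * inverse (M * d)" unfolding p3 using M d by (simp add: field_simps)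
  moreover have "inverse (M * d) \<in> K" using M d K_closed by simp
  ultimately show "s \<in> adjoin K (s * c)"
    using adjoin_closed(4)[OF adjoin_closed(7)[OF t_in_adjoin] K_in_adjoin] by metis
  have "c = (s * c) ^ 4 * inverse (M\<^sup>2 * d)" unfolding p4 using M d by (simp add: field_simps)
  moreover have "inverse (M\<^sup>2 * d) \<in> K" using M d K_closed by simp
  ultimately show "c \<in> adjoin K (s * c)"
    using adjoin_closed(4)[OF adjoin_closed(7)[OF t_in_adjoin] K_in_adjoin] by metis
qed

lemma exists_cubic_point:
  assumes AB: "A \<in> K" "B \<in> K" "A = 0 \<or> unit A" "B \<in> V" and 23: "unit 2" "unit 3"
  shows "\<exists>t x y. kummer_point 3 A B t x y"
proof (cases "A = 0")
  case True
  \<comment> \<open>Take y = 1/\<pi> and let x be a cube root of y^2 - B. Then x^3 has value -2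
    v(\<pi>), and z^3 = x^3 \<pi>^3 has value v(\<pi>).\<close>
  define d where "d = 1 / \<pi>\<^sup>2 - B"
  obtain c where c: "c ^ 3 = d" using nth_root_exists[of 3 d] by auto
  have "unit (1 - B * \<pi>\<^sup>2)" using AB small_pi by (intro unit_diff_small small_mult' small_power) auto
  then have d: "unit (d * \<pi>\<^sup>2)" using pi_nonzero by (simp add: d_def left_diff_distrib)
  have "c \<noteq> 0" using unit_nonzero[OF d] c by auto
  have "unit (c ^ 3 / \<pi> powi (- 2))" using d by (simp add: c power_int_minus field_simps)
  moreover have "coprime (- 2) (int 3)" by code_simp
  moreover have "(c / (1 / \<pi>)) ^ 3 / \<pi> = d * \<pi>\<^sup>2"
    unfolding c [symmetric] using pi_nonzero by (simp add: power3_eq_cube power2_eq_square mult_ac)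
  moreover have "(1 / \<pi>)\<^sup>2 = c ^ 3 + A * c + B" using True by (simp add: c d_def power_divide)
  moreover have "d \<in> K" "1 / \<pi> \<in> K" using AB pi_K K_closed by (auto simp: d_def)
  ultimately have "kummer_point 3 A B c c (1 / \<pi>)"
    unfolding kummer_point_def using d \<open>c \<noteq> 0\<close> small_pi pi_nonzero t_in_adjoin K_in_adjoin
    by (auto simp: c)
  then show ?thesis by blast
next
  case False
  \<comment> \<open>Now 3 a = \<pi>^2 is a square in K, so s = \<pi> and only the cube root c has to
    be adjoined.\<close>
  define a where "a = \<pi>\<^sup>2 / 3"
  have "small a"
    unfolding a_def divide_inverse
    using small_pi 23(2) by (intro small_mult small_power unit_mem unit_inverse) auto
  moreover have "a \<in> K"
    unfolding a_def by (rule K_closed(11)[OF K_closed(7)[OF pi_K] K_closed(13)])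
  ultimately have a: "a \<in> K" "a \<noteq> 0" "small a" "unit A" "\<pi>\<^sup>2 = 3 * a"
    using pi_nonzero AB(3) False by (simp_all add: a_def)
  obtain c d g where c: "c ^ 3 = d" "d \<in> K" "d \<noteq> 0" "unit (d * a)" "g \<in> K"
    "(\<pi> * (g + c))\<^sup>2 = (a + c) ^ 3 + A * (a + c) + B" "\<pi> * (g + c) \<noteq> 0"
    "unit (((a + c) / (\<pi> * (g + c))) ^ 6 / a)" "small (1 / (\<pi> * (g + c)))"
    using cubic_point[OF a(1-3) AB(1) a(4) AB(2,4) 23 a(5)] by metis
  define z where "z = (a + c) / (\<pi> * (g + c))"
  have "unit (z ^ 6 / a / 3)" unfolding z_def by (rule unit_divide[OF c(8) 23(2)])
  moreover have "z ^ 6 / a / 3 = (z ^ 3 / \<pi>)\<^sup>2"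
    by (simp add: a_def power_divide)
  ultimately have z: "unit (z ^ 3 / \<pi>)" by (metis unit_if_power_unit zero_less_numeral)
  have "unit (3 * (d * a))" by (rule unit_mult[OF 23(2) c(4)])
  then have "unit (c ^ 3 / \<pi> powi (- 2))"
    unfolding c(1) by (simp add: a_def power_int_minus field_simps)
  moreover have "coprime (- 2) (int 3)" by code_simp
  moreover have "a + c \<in> adjoin K c" "\<pi> * (g + c) \<in> adjoin K c"
    using a(1)[THEN K_in_adjoin] c(5)[THEN K_in_adjoin] pi_K[THEN K_in_adjoin] t_in_adjoin
    by (auto intro!: adjoin_closed(4,6))
  moreover have "c \<noteq> 0" using c(1,3) by auto
  ultimately have "kummer_point 3 A B c (a + c) (\<pi> * (g + c))"
    unfolding kummer_point_def using c z[unfolded z_def] by auto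
  then show ?thesis by blast
qed

lemma exists_sextic_point:
  assumes AB: "A \<in> K" "B \<in> K" "A = 0 \<or> unit A" "B \<in> V" and 23: "unit 2" "unit 3"
  shows "\<exists>t x y. kummer_point 6 A B t x y"
proof (cases "A = 0")
  case True
  \<comment> \<open>Take x with x^3 = 1/\<pi> and y with y^2 = x^3 + B. Then z^6 = d^2 / M^3 has
    value v(\<pi>), and t = s c has t^6 of value -5 v(\<pi>).\<close>
  define d where "d = 1 / \<pi>"
  define M where "M = d + B"
  define s where "s = csqrt M"
  obtain c where c: "c ^ 3 = d" using nth_root_exists[of 3 d] by auto
  have s: "s\<^sup>2 = M" by (simp add: s_def)
  have "unit (1 + B * \<pi>)" using AB small_pi by (intro unit_add_small small_mult') auto
  then have M: "unit (M * \<pi>)" using pi_nonzero by (simp add: M_def d_def distrib_right)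
  have nz: "M \<noteq> 0" "d \<noteq> 0" "s \<noteq> 0" "c \<noteq> 0"
    using unit_nonzero[OF M] s c pi_nonzero by (auto simp: d_def)
  have K': "d \<in> K" "M \<in> K" using AB pi_K K_closed by (auto simp: d_def M_def)
  note rad = sextic_radicals[OF K'(2) nz(1) K'(1) nz(2) s c]
  have s6: "s ^ 6 = M ^ 3" and c6: "c ^ 6 = d\<^sup>2"
    unfolding s [symmetric] c [symmetric] by simp_all
  have "unit ((M * \<pi>) ^ 3)" "unit (inverse ((M * \<pi>) ^ 3))" using M by (auto intro: unit_power unit_inverse)
  moreover have "(M * \<pi>) ^ 3 = (s * c) ^ 6 / \<pi> powi (- 5)"
    unfolding rad(1) using pi_nonzero
    by (simp add: d_def power_int_minus power_mult_distrib power_divide field_simps)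
  moreover have "inverse ((M * \<pi>) ^ 3) = (c / s) ^ 6 / \<pi>"
    using nz pi_nonzero by (simp add: power_divide s6 c6 d_def power_mult_distrib field_simps)
      (simp add: power2_eq_square power3_eq_cube)
  moreover have "small (1 / s)"
  proof (rule small_if_small_power)
    have "small (\<pi> * inverse (M * \<pi>))" using M small_pi by (intro small_mult unit_mem unit_inverse)
    then show "small ((1 / s)\<^sup>2)" using pi_nonzero by (simp add: power_divide s field_simps)
  qed simp
  moreover have "coprime (- 5) (int 6)" by code_simp
  moreover have "s\<^sup>2 = c ^ 3 + A * c + B" using True by (simp add: s c M_def)
  moreover have "(s * c) ^ 6 \<in> K" unfolding rad(1) using K' K_closed by simp
  ultimately have "kummer_point 6 A B (s * c) c s"
    unfolding kummer_point_def using nz rad by auto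
  then show ?thesis by blast
next
  case False
  \<comment> \<open>With a = \<pi> the square root of 3 a is a genuine new radical. For t = s c, t^6
    = 27 \<pi>^3 d^2 has value v(\<pi>).\<close>
  define s where "s = csqrt (3 * \<pi>)"
  have s: "s\<^sup>2 = 3 * \<pi>" by (simp add: s_def)
  have A: "unit A" using AB False by simp
  obtain c d g where c: "c ^ 3 = d" "d \<in> K" "d \<noteq> 0" "unit (d * \<pi>)" "g \<in> K"
    "(s * (g + c))\<^sup>2 = (\<pi> + c) ^ 3 + A * (\<pi> + c) + B" "s * (g + c) \<noteq> 0"
    "unit (((\<pi> + c) / (s * (g + c))) ^ 6 / \<pi>)" "small (1 / (s * (g + c)))"
    using cubic_point[OF pi_K pi_nonzero small_pi AB(1) A AB(2,4) 23 s] by metis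
  have K': "3 * \<pi> \<in> K" "3 * \<pi> \<noteq> 0" using pi_K pi_nonzero K_closed by auto
  note rad = sextic_radicals[OF K' c(2,3) s c(1)]
  have 27: "unit (27 :: complex)" using unit_power[OF 23(2), of 3] by simp
  have "unit (27 * (d * \<pi>)\<^sup>2)" by (rule unit_mult[OF 27 unit_power[OF c(4)]])
  also have "27 * (d * \<pi>)\<^sup>2 = (s * c) ^ 6 / \<pi> powi 1"
    unfolding rad(1) using pi_nonzero by (simp add: power_mult_distrib field_simps power3_eq_cube power2_eq_square)
  finally have "unit ((s * c) ^ 6 / \<pi> powi 1)" .
  moreover have "coprime 1 (int 6)" by simp
  moreover have "(s * c) ^ 6 \<in> K" unfolding rad(1) by (rule K_closed(4)[OF K_closed(7)[OF K'(1)] K_closed(7)[OF c(2)]])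
  moreover have "s * c \<noteq> 0" using c s K' by auto
  moreover have "\<pi> + c \<in> adjoin K (s * c)" "s * (g + c) \<in> adjoin K (s * c)"
    using rad(2,3) c(5)[THEN K_in_adjoin] pi_K[THEN K_in_adjoin]
    by (auto intro!: adjoin_closed(4,6))
  ultimately have "kummer_point 6 A B (s * c) (\<pi> + c) (s * (g + c))"
    unfolding kummer_point_def using c by blast
  then show ?thesis by blast
qed

end

section \<open>Avoiding finitely many extensions\<close>

lemma ex_new_kummer_extension:
  fixes n :: nat and K :: "complex set" and A B :: complex
  assumes n: "n \<in> {3, 4, 6}" and nf: "number_field K" and roots: "\<forall>z::complex. z ^ n = 1 \<longrightarrow> z \<in> K"
    and ec: "elliptic_curve_over K A B" and S: "finite S" "S \<subseteq> K - {0}"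
  obtains t V where "kummer K n t" "gains_rank K A B (adjoin K t)" "valuation_ring V"
    "\<And>x. x \<in> S \<Longrightarrow> valuation_ring.unit V x" "\<And>y. y \<in> K \<Longrightarrow> y \<noteq> 0 \<Longrightarrow> \<not> valuation_ring.unit V (y * t)"
proof -
  have K: "subfield_set K" using nf by (simp add: number_field_def subfield_CC_iff)
  note K_closed = subfield_setD[OF K]
  obtain N where N: "\<And>x. x \<in> K \<Longrightarrow> int_relation N x"
    using number_field_int_relation[OF nf] by blast
  have AB: "A \<in> K" "B \<in> K" "4 * A ^ 3 + 27 * B ^ 2 \<noteq> 0" using ec by (auto simp: elliptic_curve_over_def)
  \<comment> \<open>2 and 3 occur as denominators in the explicit points; nonzero A and B must be
    units so that the leading terms there have the intended values.\<close>
  define S' where "S' = S \<union> ({A, B, 2, 3} - {0})"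
  have "finite S'" "S' \<subseteq> K - {0}" using S AB K_closed(13) by (auto simp: S'_def)
  from units_almost_everywhere[OF K N this] obtain M where M: "M > 0"
    "\<And>V p. padic_valuation_ring V p \<Longrightarrow> \<not> p dvd M \<Longrightarrow> \<forall>x\<in>S'. valuation_ring.unit V x"
    by blast
  \<comment> \<open>The summand M keeps p from dividing M; the rest is the bound of
    \<open>small_log_coefficient\<close> with E = N!.\<close>
  obtain p where p: "Factorial_Ring.prime p" "p > M + n * fact N + 1"
    using bigger_prime by blast
  obtain V :: "complex set" where V: "valuation_ring V" "inverse (of_nat p) \<notin> V"
    using ex_valuation_ring[of p] p(2) by auto
  interpret padic_valuation_ring V p
    using V p by (simp add: padic_valuation_ring_def padic_valuation_ring_axioms_def)
  have pV: "padic_valuation_ring V p" by unfold_locales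
  have "\<not> p dvd M" using M(1) p(2) by (auto dest: dvd_imp_le)
  then have units: "unit x" if "x \<in> S'" for x using M(2)[OF pV] that by blast
  obtain \<pi> where \<pi>: "\<pi> \<in> K" "\<pi> \<noteq> 0" "small \<pi>" "\<pi> ^ fact N / of_nat p \<in> V"
    "\<And>x. x \<in> K \<Longrightarrow> x \<noteq> 0 \<Longrightarrow> \<exists>k::int. unit (x / \<pi> powi k)"
    using ex_uniformizer[OF K N] by metis
  interpret uniformized_valuation_ring V p K \<pi> "fact N"
    using K \<pi> by unfold_locales auto
  have u23: "unit 2" "unit 3" using units by (auto simp: S'_def)
  have uAB: "A = 0 \<or> unit A" "B = 0 \<or> unit B" using units by (auto simp: S'_def)
  then have VAB: "A \<in> V" "B \<in> V" using unit_mem by auto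
  have "\<exists>t x y. kummer_point n A B t x y"
    using n exists_cubic_point exists_quartic_point exists_sextic_point AB uAB VAB u23 by auto
  then obtain t x y where "kummer_point n A B t x y" by blast
  then obtain r where P: "t \<noteq> 0" "t ^ n \<in> K" "unit (t ^ n / \<pi> powi r)" "coprime r (int n)"
    "y\<^sup>2 = x ^ 3 + A * x + B" "x \<in> adjoin K t" "y \<in> adjoin K t"
    "unit ((x / y) ^ n / \<pi>)" "small (1 / y)" "y \<noteq> 0"
    unfolding kummer_point_def by blast
  have n1: "n > 1" and roots': "\<And>z. z ^ n = 1 \<Longrightarrow> z \<in> K" using n roots by auto
  have pn: "p > n * fact N + 1" using p(2) by simp
  have "\<not> unit (z * t)" if "z \<in> K" "z \<noteq> 0" for z
  proof -
    have "\<not> int n dvd 1" using n1 by simp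
    then show ?thesis
      using not_associated_to_K[of t 1 n r z 1] P K_closed(1) that by simp
  qed
  then show ?thesis
    using that[of t V] kummer_gains_rank[OF n1 roots' P(1-4) AB(1) VAB P(5-10) pn] units
      valuation_ring_axioms by (auto simp: S'_def)
qed

theorem theorem1p3:
  fixes n :: nat and K :: "complex set" and A B :: complex
  assumes "n \<in> {3, 4, 6}"
    and "number_field K"
    and "\<forall>z::complex. z ^ n = 1 \<longrightarrow> z \<in> K"
    and "elliptic_curve_over K A B"
  shows "infinite {L. cyclic_extension n K L \<and> gains_rank K A B L}"
proof -
  define F where "F = {L. \<exists>t. kummer K n t \<and> L = adjoin K t \<and> gains_rank K A B L}"
  have "infinite F"
  proof
    assume fin: "finite F"
    have "\<forall>L\<in>F. \<exists>t. kummer K n t \<and> L = adjoin K t" by (auto simp: F_def)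
    then obtain \<tau> where \<tau>: "\<And>L. L \<in> F \<Longrightarrow> kummer K n (\<tau> L) \<and> L = adjoin K (\<tau> L)" by metis
    \<comment> \<open>The generators need not lie in K, so their n-th powers are made units; this
      makes the generators units too.\<close>
    have "(\<lambda>L. \<tau> L ^ n) ` F \<subseteq> K - {0}"
      using \<tau> kummer.t_power kummer.t_nonzero by fastforce
    from ex_new_kummer_extension[OF assms finite_imageI[OF fin] this] obtain t V where t: "kummer K n t"
      "gains_rank K A B (adjoin K t)" "valuation_ring V"
      "\<And>L. L \<in> F \<Longrightarrow> valuation_ring.unit V (\<tau> L ^ n)"
      "\<And>y. y \<in> K \<Longrightarrow> y \<noteq> 0 \<Longrightarrow> \<not> valuation_ring.unit V (y * t)" by (metis imageI)
    interpret valuation_ring V by fact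
    define s where "s = \<tau> (adjoin K t)"
    have F: "adjoin K t \<in> F" using t(1,2) by (auto simp: F_def)
    interpret s: kummer K n s using \<tau>[OF F] by (simp add: s_def)
    interpret t: kummer K n t by fact
    have "adjoin K t = adjoin K s" using \<tau>[OF F] by (simp add: s_def)
    then have "t \<in> s.L" using t.t_in_L by (simp add: t.L_def s.L_def)
    then obtain c j where c: "c \<in> K" "t = c * s ^ j"
      using s.nth_root_in_L[OF _ t.t_power t.t_nonzero] by blast
    have "c \<noteq> 0" using c(2) t.t_nonzero by auto
    have "unit s" using t(4)[OF F] s.n by (intro unit_if_power_unit[of s n]) (auto simp: s_def)
    moreover have "inverse c * t = s ^ j" using \<open>c \<noteq> 0\<close> c(2) by (simp add: field_simps)
    ultimately have "unit (inverse c * t)" by (simp only: unit_power)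
    moreover have "inverse c \<in> K" "inverse c \<noteq> 0" using c(1) \<open>c \<noteq> 0\<close> s.K_closed(10) by auto
    ultimately show False using t(5) by blast
  qed
  moreover have "F \<subseteq> {L. cyclic_extension n K L \<and> gains_rank K A B L}"
    using kummer.cyclic_extension_L kummer.L_def by (auto simp: F_def)
  ultimately show ?thesis using finite_subset by blast
qed

end
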